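(* Let $\mathbf{A}$ be an idempotent algebra which satisfies a non-trivial set of identities. Then $\mathbf{A}$ also satisfies the loop condition $L^3_4$.
   Context: An algebra is idempotent if all its operations $g$ satisfy $g(c,\dots,c)=c$ for all elements $c$ of the domain. An identity is a formal expression $u\approx v$, where $u,v$ are abstract terms over some functional signature $\Omega$; a set of identities over $\Omega$ is satisfied in an algebra $\mathbf{A}$ if the symbols of $\Omega$ can be assigned term operations of $\mathbf{A}$ (of the corresponding arities) such that all the resulting equations hold for all values of the variables in the domain of $\mathbf{A}$ (the signature $\Omega$ is unrelated to that of $\mathbf{A}$). A set of identities is non-trivial if it cannot be satisfied in any algebra on an at least two-element domain whose only fundamental operations are projections. The loop condition $L^3_4$ is the set of identities $f(r_{1,1},\ldots,r_{1,60})\approx f(r_{2,1},\ldots,r_{2,60})\approx f(r_{3,1},\ldots,r_{3,60})$, where $(r_{1,i},r_{2,i},r_{3,i})$, $1\le i\le 60$, is an enumeration of all triples in $\{1,2,3,4\}^3$ that are not constant, and $1,2,3,4$ are regarded as variables (the choice of enumeration is irrelevant for satisfaction). *)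

theory Defs
  imports Main
begin

text \<open>A signature is a partial function assigning arities to its symbols; its domain is the set of
  symbols. Nullary symbols are allowed.\<close>

datatype ('f, 'v) trm = Var 'v | App 'f "('f, 'v) trm list"

type_synonym ('f, 'v) identity = "('f, 'v) trm \<times> ('f, 'v) trm"

inductive_set terms :: "('f \<rightharpoonup> nat) \<Rightarrow> 'v set \<Rightarrow> ('f, 'v) trm set"
  for \<Omega> :: "'f \<rightharpoonup> nat" and V :: "'v set" where
  Var: "x \<in> V \<Longrightarrow> Var x \<in> terms \<Omega> V"
| App: "\<Omega> f = Some (length ts) \<Longrightarrow> (\<And>t. t \<in> set ts \<Longrightarrow> t \<in> terms \<Omega> V) \<Longrightarrow> App f ts \<in> terms \<Omega> V"

primrec eval :: "('f \<Rightarrow> 'a list \<Rightarrow> 'a) \<Rightarrow> ('v \<Rightarrow> 'a) \<Rightarrow> ('f, 'v) trm \<Rightarrow> 'a" where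
  "eval I \<rho> (Var x) = \<rho> x"
| "eval I \<rho> (App f ts) = I f (map (eval I \<rho>) ts)"

definition identities_over :: "('f \<rightharpoonup> nat) \<Rightarrow> ('f, 'v) identity set \<Rightarrow> bool" where
  "identities_over \<Omega> E \<longleftrightarrow> E \<subseteq> terms \<Omega> UNIV \<times> terms \<Omega> UNIV"

text \<open>An n-ary operation is a function on lists; only its values on lists of length n over the
  carrier matter.\<close>

record ('g, 'a) algebra =
  carrier :: "'a set"
  signature :: "'g \<rightharpoonup> nat"
  interp :: "'g \<Rightarrow> 'a list \<Rightarrow> 'a"

definition tuples :: "'a set \<Rightarrow> nat \<Rightarrow> 'a list set" where
  "tuples S n = {xs. length xs = n \<and> set xs \<subseteq> S}"

definition is_algebra :: "('g, 'a) algebra \<Rightarrow> bool" where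
  "is_algebra A \<longleftrightarrow> carrier A \<noteq> {} \<and>
     (\<forall>g n. signature A g = Some n \<longrightarrow> (\<forall>xs\<in>tuples (carrier A) n. interp A g xs \<in> carrier A))"

definition idempotent :: "('g, 'a) algebra \<Rightarrow> bool" where
  "idempotent A \<longleftrightarrow>
     (\<forall>g n. signature A g = Some n \<longrightarrow> (\<forall>c\<in>carrier A. interp A g (replicate n c) = c))"

definition term_operation :: "('g, 'a) algebra \<Rightarrow> nat \<Rightarrow> ('a list \<Rightarrow> 'a) \<Rightarrow> bool" where
  "term_operation A n h \<longleftrightarrow>
     (\<exists>t\<in>terms (signature A) {..<n}. \<forall>xs\<in>tuples (carrier A) n. h xs = eval (interp A) (\<lambda>i. xs ! i) t)"

definition satisfies :: "('g, 'a) algebra \<Rightarrow> ('f \<rightharpoonup> nat) \<Rightarrow> ('f, 'v) identity set \<Rightarrow> bool" where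
  "satisfies A \<Omega> E \<longleftrightarrow>
     (\<exists>I. (\<forall>f n. \<Omega> f = Some n \<longrightarrow> term_operation A n (I f)) \<and>
          (\<forall>(u, v)\<in>E. \<forall>\<rho>. range \<rho> \<subseteq> carrier A \<longrightarrow> eval I \<rho> u = eval I \<rho> v))"

definition projection_algebra :: "('g, 'a) algebra \<Rightarrow> bool" where
  "projection_algebra A \<longleftrightarrow> is_algebra A \<and>
     (\<forall>g n. signature A g = Some n \<longrightarrow>
        (\<exists>i<n. \<forall>xs\<in>tuples (carrier A) n. interp A g xs = xs ! i))"

text \<open>HOL cannot quantify over types inside a definition, so the algebras below have symbols and
  elements of type nat. This loses nothing: the lemma \<open>nontrivial_not_satisfies\<close> shows that a
  non-trivial set of identities fails in every projection algebra with at least two elements,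
  whatever the types of its symbols and elements.\<close>

definition nontrivial :: "('f \<rightharpoonup> nat) \<Rightarrow> ('f, 'v) identity set \<Rightarrow> bool" where
  "nontrivial \<Omega> E \<longleftrightarrow>
     \<not> (\<exists>B :: (nat, nat) algebra. projection_algebra B \<and>
          (\<exists>a\<in>carrier B. \<exists>b\<in>carrier B. a \<noteq> b) \<and> satisfies B \<Omega> E)"

lemma projection_algebra_eval:
  assumes "projection_algebra B" "t \<in> terms (signature B) V"
  shows "\<exists>x\<in>V. \<forall>\<rho>. \<rho> ` V \<subseteq> carrier B \<longrightarrow> eval (interp B) \<rho> t = \<rho> x"
  using assms(2)
proof (induction rule: terms.induct)
  case (Var x)
  then show ?case by auto
next
  case (App g ts)
  from assms(1) App.hyps(1) obtain i where i: "i < length ts"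
    "\<forall>xs\<in>tuples (carrier B) (length ts). interp B g xs = xs ! i"
    unfolding projection_algebra_def by blast
  from App.IH have ih: "\<forall>t\<in>set ts. \<exists>x\<in>V. \<forall>\<rho>. \<rho> ` V \<subseteq> carrier B \<longrightarrow> eval (interp B) \<rho> t = \<rho> x"
    by blast
  from bspec[OF this nth_mem[OF i(1)]] obtain x where x: "x \<in> V"
    "\<forall>\<rho>. \<rho> ` V \<subseteq> carrier B \<longrightarrow> eval (interp B) \<rho> (ts ! i) = \<rho> x"
    by blast
  have "eval (interp B) \<rho> (App g ts) = \<rho> x" if \<rho>: "\<rho> ` V \<subseteq> carrier B" for \<rho>
  proof -
    have "eval (interp B) \<rho> t \<in> carrier B" if "t \<in> set ts" for t
      using bspec[OF ih that] \<rho> by (metis image_subset_iff)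
    then have "map (eval (interp B) \<rho>) ts \<in> tuples (carrier B) (length ts)"
      by (auto simp: tuples_def)
    then show ?thesis using i x(2) \<rho> by simp
  qed
  with x(1) show ?case by blast
qed

lemma nontrivial_not_satisfies:
  fixes B :: "('g, 'b) algebra"
  assumes "identities_over \<Omega> E" "nontrivial \<Omega> E" "projection_algebra B"
    and ab: "a \<in> carrier B" "b \<in> carrier B" "a \<noteq> b"
  shows "\<not> satisfies B \<Omega> E"
proof
  assume "satisfies B \<Omega> E"
  then obtain I where I: "\<And>f n. \<Omega> f = Some n \<Longrightarrow> term_operation B n (I f)"
    and E: "\<And>u v \<rho>. (u, v) \<in> E \<Longrightarrow> range \<rho> \<subseteq> carrier B \<Longrightarrow> eval I \<rho> u = eval I \<rho> v"
    unfolding satisfies_def by blast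
  have "\<exists>i. \<forall>n. \<Omega> f = Some n \<longrightarrow> i < n \<and> (\<forall>xs\<in>tuples (carrier B) n. I f xs = xs ! i)" for f
  proof (cases "\<Omega> f")
    case (Some n)
    from I[OF Some] obtain t where t: "t \<in> terms (signature B) {..<n}"
      "\<forall>xs\<in>tuples (carrier B) n. I f xs = eval (interp B) (\<lambda>i. xs ! i) t"
      unfolding term_operation_def by blast
    from projection_algebra_eval[OF assms(3) t(1)] obtain i where i: "i < n"
      "\<forall>\<rho>. \<rho> ` {..<n} \<subseteq> carrier B \<longrightarrow> eval (interp B) \<rho> t = \<rho> i" by auto
    have "I f xs = xs ! i" if "xs \<in> tuples (carrier B) n" for xs
    proof -
      have "(\<lambda>i. xs ! i) ` {..<n} \<subseteq> carrier B" using that unfolding tuples_def by auto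
      then show ?thesis using t(2) i(2) that by simp
    qed
    then show ?thesis using i(1) Some by auto
  qed simp
  then obtain p where p: "\<And>f n. \<Omega> f = Some n \<Longrightarrow> p f < n"
    "\<And>f n xs. \<Omega> f = Some n \<Longrightarrow> xs \<in> tuples (carrier B) n \<Longrightarrow> I f xs = xs ! p f"
    by metis
  define J :: "'a \<Rightarrow> nat list \<Rightarrow> nat" where "J f xs = xs ! p f" for f xs
  define C :: "(nat, nat) algebra" where
    "C = \<lparr>carrier = {0, 1}, signature = Map.empty, interp = (\<lambda>_ _. 0)\<rparr>"
  have sel: "\<exists>x. (\<forall>\<rho>. range \<rho> \<subseteq> carrier B \<longrightarrow> eval I \<rho> t = \<rho> x) \<and> (\<forall>\<rho>. eval J \<rho> t = \<rho> x)"
    if "t \<in> terms \<Omega> UNIV" for t :: "('a, 'c) trm"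
    using that
  proof (induction rule: terms.induct)
    case (Var x)
    then show ?case by auto
  next
    case (App f ts)
    have l: "p f < length ts" using p(1) App.hyps(1) by blast
    from App.IH have ih: "\<forall>t\<in>set ts. \<exists>x. (\<forall>\<rho>. range \<rho> \<subseteq> carrier B \<longrightarrow> eval I \<rho> t = \<rho> x) \<and>
        (\<forall>\<rho>. eval J \<rho> t = \<rho> x)" by blast
    from bspec[OF this nth_mem[OF l]]
    obtain x where x: "\<forall>\<rho>. range \<rho> \<subseteq> carrier B \<longrightarrow> eval I \<rho> (ts ! p f) = \<rho> x"
      "\<forall>\<rho>. eval J \<rho> (ts ! p f) = \<rho> x" by blast
    have "eval I \<rho> (App f ts) = \<rho> x" if \<rho>: "range \<rho> \<subseteq> carrier B" for \<rho>
    proof -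
      have "eval I \<rho> t \<in> carrier B" if "t \<in> set ts" for t
        using bspec[OF ih that] \<rho> by (metis range_subsetD)
      then have "map (eval I \<rho>) ts \<in> tuples (carrier B) (length ts)"
        by (auto simp: tuples_def)
      then show ?thesis using p(2)[OF App.hyps(1)] x(1) \<rho> l by simp
    qed
    moreover have "eval J \<rho> (App f ts) = \<rho> x" for \<rho> using x(2) l by (simp add: J_def)
    ultimately show ?case by blast
  qed
  have "eval J \<rho> u = eval J \<rho> v" if uv: "(u, v) \<in> E" for u v \<rho>
  proof -
    have "u \<in> terms \<Omega> UNIV" "v \<in> terms \<Omega> UNIV"
      using assms(1) uv unfolding identities_over_def by auto
    from sel[OF this(1)] sel[OF this(2)] obtain x y where
      x: "\<And>\<rho>. range \<rho> \<subseteq> carrier B \<Longrightarrow> eval I \<rho> u = \<rho> x" "\<And>\<rho>. eval J \<rho> u = \<rho> x" and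
      y: "\<And>\<rho>. range \<rho> \<subseteq> carrier B \<Longrightarrow> eval I \<rho> v = \<rho> y" "\<And>\<rho>. eval J \<rho> v = \<rho> y"
      by metis
    define \<sigma> where "\<sigma> z = (if z = x then a else b)" for z
    have r: "range \<sigma> \<subseteq> carrier B" using ab by (auto simp: \<sigma>_def)
    have "\<sigma> x = \<sigma> y" using E[OF uv r] x(1)[OF r] y(1)[OF r] by simp
    then have "x = y" using ab(3) by (auto simp: \<sigma>_def split: if_splits)
    then show ?thesis using x(2) y(2) by simp
  qed
  moreover have "term_operation C n (J f)" if "\<Omega> f = Some n" for f n
    unfolding term_operation_def
    by (rule bexI[of _ "Var (p f)"]) (use p(1)[OF that] in \<open>auto simp: J_def intro: terms.Var\<close>)
  ultimately have "satisfies C \<Omega> E" unfolding satisfies_def by blast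
  moreover have "projection_algebra C" "\<exists>a\<in>carrier C. \<exists>b\<in>carrier C. a \<noteq> b"
    by (auto simp: C_def projection_algebra_def is_algebra_def)
  ultimately show False using assms(2) unfolding nontrivial_def by blast
qed

definition nonconstant_triples :: "(nat \<times> nat \<times> nat) set" where
  "nonconstant_triples = {(a, b, c). {a, b, c} \<subseteq> {1..4} \<and> \<not> (a = b \<and> b = c)}"

lemma nonconstant_triples_eq:
  "nonconstant_triples = {1..4} \<times> {1..4} \<times> {1..4} - (\<lambda>a. (a, a, a)) ` {1..4}"
  unfolding nonconstant_triples_def by auto

lemma card_nonconstant_triples: "card nonconstant_triples = 60"
proof -
  have "card ((\<lambda>a. (a, a, a)) ` {1..4 :: nat}) = 4"
    by (subst card_image) (auto simp: inj_on_def)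
  then show ?thesis
    unfolding nonconstant_triples_eq
    by (subst card_Diff_subset) (auto simp: card_cartesian_product)
qed

text \<open>The only operation symbol is the element of unit, of arity 60; \<open>ts\<close> is the enumeration of
  the non-constant triples.\<close>

definition loop_signature_3_4 :: "unit \<rightharpoonup> nat" where
  "loop_signature_3_4 = [() \<mapsto> 60]"

definition loop_condition_3_4 :: "(nat \<times> nat \<times> nat) list \<Rightarrow> (unit, nat) identity set" where
  "loop_condition_3_4 ts =
     (let t1 = App () (map (\<lambda>(a, b, c). Var a) ts);
          t2 = App () (map (\<lambda>(a, b, c). Var b) ts);
          t3 = App () (map (\<lambda>(a, b, c). Var c) ts)
      in {(t1, t2), (t2, t3)})"

lemma identities_over_loop_condition_3_4:
  assumes "distinct ts" "set ts = nonconstant_triples"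
  shows "identities_over loop_signature_3_4 (loop_condition_3_4 ts)"
proof -
  have "length ts = 60"
    using distinct_card[OF assms(1)] assms(2) card_nonconstant_triples by simp
  then show ?thesis
    by (auto simp: identities_over_def loop_condition_3_4_def loop_signature_3_4_def Let_def
        intro!: terms.App terms.Var)
qed

end

theory Submission
  imports Defs "HOL-Analysis.Product_Topology"
begin

text \<open>Let R be the ternary relation on the free algebra over 1, 2, 3, 4 that is generated by the
  non-constant triples of generators; the loop condition holds if and only if R contains a constant
  triple. A triple lies in R as soon as its three entries can be unfolded in parallel, argument by
  argument, into triples in R, where by idempotence each entry w may also be unfolded trivially as
  f(w, ..., w).

  Every choice of one coordinate for each basic operation violates some binary identity of the
  algebra, and by compactness finitely many identities suffice for this. They yield an operation f
  and finitely many equations f(p) = f(q) with p, q tuples over x, y such that at every coordinate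
  some equation has different entries. Replacing f by its self-composition and encoding the number of
  an equation in binary, one brings the number of equations down to three. Then a constant triple
  in R can be written down, see \<open>covered_three_const\<close>.\<close>

section \<open>Terms, evaluation and substitution\<close>

lemma eval_cong:
  assumes "t \<in> terms \<Omega> V" "\<And>x. x \<in> V \<Longrightarrow> \<rho> x = \<rho>' x"
  shows "eval I \<rho> t = eval I \<rho>' t"
  using assms(1) by induction (auto simp: assms(2) intro: arg_cong[where f = "I _"])

lemma eval_closed:
  assumes "is_algebra A" "t \<in> terms (signature A) V" "\<And>x. x \<in> V \<Longrightarrow> \<rho> x \<in> carrier A"
  shows "eval (interp A) \<rho> t \<in> carrier A"
  using assms(2)
proof induction
  case (App f ts)
  then have "map (eval (interp A) \<rho>) ts \<in> tuples (carrier A) (length ts)"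
    by (auto simp: tuples_def)
  with App.hyps assms(1) show ?case unfolding is_algebra_def by simp
qed (use assms(3) in simp)

text \<open>Evaluation in the term algebra, that is \<^term>\<open>eval App\<close>, is substitution.\<close>

lemma eval_subst: "eval I \<rho> (eval App \<sigma> t) = eval I (\<lambda>x. eval I \<rho> (\<sigma> x)) t"
  by (induction t) (auto intro: arg_cong[where f = "I _"])

lemma subst_in_terms:
  assumes "t \<in> terms \<Omega> V" "\<And>x. x \<in> V \<Longrightarrow> \<sigma> x \<in> terms \<Omega> W"
  shows "eval App \<sigma> t \<in> terms \<Omega> W"
  using assms(1) by induction (auto intro!: terms.App simp: assms(2))

section \<open>Binary identities and choices of coordinates\<close>

text \<open>Two variables suffice because only a two-element projection algebra has to be excluded:
  a valuation in \<open>{0, 1}\<close> turns every identity into a binary one.\<close>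

definition binary_identities :: "('g, 'a) algebra \<Rightarrow> ('g, nat) identity set" where
  "binary_identities A = {(t, t'). t \<in> terms (signature A) {0, 1} \<and> t' \<in> terms (signature A) {0, 1} \<and>
     (\<forall>\<rho>. range \<rho> \<subseteq> carrier A \<longrightarrow> eval (interp A) \<rho> t = eval (interp A) \<rho> t')}"

text \<open>The value in the projection algebra where \<open>g\<close> returns its argument number
  \<open>\<pi> g\<close>: the variable at the end of the branch that \<open>\<pi>\<close>
  selects.\<close>

definition leading_var :: "('g \<Rightarrow> nat) \<Rightarrow> ('g, 'v) trm \<Rightarrow> 'v" where
  "leading_var \<pi> = eval (\<lambda>g xs. xs ! \<pi> g) (\<lambda>x. x)"

lemma leading_var_simps [simp]:
  "leading_var \<pi> (Var x) = x"
  "\<pi> g < length ts \<Longrightarrow> leading_var \<pi> (App g ts) = leading_var \<pi> (ts ! \<pi> g)"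
  by (simp_all add: leading_var_def)

text \<open>If \<open>\<pi>\<close> respected all binary identities of \<open>A\<close>, the
  projections chosen by \<open>\<pi>\<close> on \<open>{0, 1}\<close> would satisfy
  \<open>E\<close>: the terms that interpret \<open>E\<close> in \<open>A\<close> would do so there
  as well.\<close>

lemma violated_identity:
  fixes A :: "('g, 'a) algebra" and E :: "('f, 'v) identity set"
  assumes "is_algebra A" "identities_over \<Omega> E" "nontrivial \<Omega> E" "satisfies A \<Omega> E"
    and \<pi>: "\<And>g n. signature A g = Some n \<Longrightarrow> \<pi> g < n"
  shows "\<exists>(t, t') \<in> binary_identities A. leading_var \<pi> t \<noteq> leading_var \<pi> t'"
proof (rule ccontr)
  assume "\<not> ?thesis"
  then have agree: "leading_var \<pi> t = leading_var \<pi> t'" if "(t, t') \<in> binary_identities A" for t t'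
    using that by blast
  obtain I where I: "\<And>f n. \<Omega> f = Some n \<Longrightarrow> term_operation A n (I f)"
    and E: "\<And>u v \<rho>. (u, v) \<in> E \<Longrightarrow> range \<rho> \<subseteq> carrier A \<Longrightarrow> eval I \<rho> u = eval I \<rho> v"
    using assms(4) unfolding satisfies_def by blast
  have "\<exists>s. \<forall>n. \<Omega> f = Some n \<longrightarrow> s \<in> terms (signature A) {..<n} \<and>
      (\<forall>xs\<in>tuples (carrier A) n. I f xs = eval (interp A) (\<lambda>i. xs ! i) s)" for f
    using I[of f] unfolding term_operation_def by (cases "\<Omega> f") auto
  then obtain s where s: "\<And>f n. \<Omega> f = Some n \<Longrightarrow> s f \<in> terms (signature A) {..<n}"
    "\<And>f n xs. \<Omega> f = Some n \<Longrightarrow> xs \<in> tuples (carrier A) n \<Longrightarrow>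
      I f xs = eval (interp A) (\<lambda>i. xs ! i) (s f)"
    by metis
  define J :: "'g \<Rightarrow> nat list \<Rightarrow> nat" where "J = (\<lambda>g xs. xs ! \<pi> g)"
  define B :: "('g, nat) algebra" where
    "B = \<lparr>carrier = {0, 1}, signature = signature A, interp = J\<rparr>"
  define I' where "I' f xs = eval J (\<lambda>i. xs ! i) (s f)" for f xs
  \<comment> \<open>\<open>tr\<close> expands a term over \<open>\<Omega>\<close> into one over the
    signature of \<open>A\<close> by means of the representing terms \<open>s f\<close>.\<close>
  define tr :: "('f, 'v) trm \<Rightarrow> ('g, 'v) trm" where
    "tr = eval (\<lambda>f ts. eval App (\<lambda>i. ts ! i) (s f)) Var"
  have tr: "tr u \<in> terms (signature A) UNIV \<and>
      (\<forall>\<sigma>. range \<sigma> \<subseteq> carrier A \<longrightarrow> eval (interp A) \<sigma> (tr u) = eval I \<sigma> u) \<and>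
      (\<forall>\<rho>. eval J \<rho> (tr u) = eval I' \<rho> u)" if "u \<in> terms \<Omega> UNIV" for u
    using that
  proof induction
    case (Var x)
    then show ?case by (auto simp: tr_def intro: terms.Var)
  next
    case (App f us)
    note sf = s(1)[OF App.hyps(1)]
    have tr_App: "tr (App f us) = eval App (\<lambda>i. map tr us ! i) (s f)" by (simp add: tr_def)
    have "tr (App f us) \<in> terms (signature A) UNIV"
      unfolding tr_App by (rule subst_in_terms[OF sf]) (use App.IH in auto)
    moreover have "eval (interp A) \<sigma> (tr (App f us)) = eval I \<sigma> (App f us)"
      if \<sigma>: "range \<sigma> \<subseteq> carrier A" for \<sigma>
    proof -
      have eq: "eval (interp A) \<sigma> (tr u) = eval I \<sigma> u" if "u \<in> set us" for u
        using App.IH[OF that] \<sigma> by blast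
      have "eval I \<sigma> u \<in> carrier A" if "u \<in> set us" for u
        using eval_closed[OF assms(1), of "tr u" UNIV \<sigma>] App.IH[OF that] eq[OF that] \<sigma> by auto
      then have tup: "map (eval I \<sigma>) us \<in> tuples (carrier A) (length us)"
        by (auto simp: tuples_def)
      have "eval (interp A) \<sigma> (tr (App f us)) =
          eval (interp A) (\<lambda>i. map (eval I \<sigma>) us ! i) (s f)"
        unfolding tr_App eval_subst by (rule eval_cong[OF sf]) (simp add: eq)
      then show ?thesis using s(2)[OF App.hyps(1) tup] by simp
    qed
    moreover have "eval J \<rho> (tr (App f us)) = eval I' \<rho> (App f us)" for \<rho>
      unfolding tr_App eval_subst eval.simps I'_def[of f]
      by (rule eval_cong[OF sf]) (use App.IH in simp)
    ultimately show ?case by blast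
  qed
  have J_leading: "eval J \<rho> t = leading_var \<pi> (eval App (\<lambda>x. Var (\<rho> x)) t)" for \<rho> :: "'v \<Rightarrow> nat" and t
    by (simp add: leading_var_def J_def eval_subst)
  have "eval I' \<rho> u = eval I' \<rho> v" if uv: "(u, v) \<in> E" and \<rho>: "range \<rho> \<subseteq> {0, 1}" for u v \<rho>
  proof -
    have u: "u \<in> terms \<Omega> UNIV" and v: "v \<in> terms \<Omega> UNIV"
      using assms(2) uv unfolding identities_over_def by auto
    \<comment> \<open>Renaming by \<open>\<rho>\<close> leaves only the variables 0 and 1, and a
      valuation of the renamed terms in \<open>A\<close> induces one of the original terms.\<close>
    have "(eval App (\<lambda>x. Var (\<rho> x)) (tr u), eval App (\<lambda>x. Var (\<rho> x)) (tr v)) \<in> binary_identities A"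
    proof -
      have "eval App (\<lambda>x. Var (\<rho> x)) (tr u) \<in> terms (signature A) {0, 1}"
           "eval App (\<lambda>x. Var (\<rho> x)) (tr v) \<in> terms (signature A) {0, 1}"
        using tr[OF u] tr[OF v] \<rho> by (blast intro: subst_in_terms terms.Var)+
      moreover have "range (\<lambda>x. \<sigma> (\<rho> x)) \<subseteq> carrier A" if "range \<sigma> \<subseteq> carrier A" for \<sigma>
        using that by auto
      ultimately show ?thesis
        unfolding binary_identities_def using tr[OF u] tr[OF v] E[OF uv]
        by (simp add: eval_subst)
    qed
    from agree[OF this] show ?thesis using tr[OF u] tr[OF v] by (simp add: J_leading[symmetric])
  qed
  moreover have "term_operation B n (I' f)" if "\<Omega> f = Some n" for f n
    unfolding term_operation_def using s(1)[OF that] by (auto simp: B_def I'_def)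
  ultimately have sat: "satisfies B \<Omega> E"
    unfolding satisfies_def by (intro exI[of _ I'] conjI) (simp add: B_def, force simp: B_def)
  have proj: "projection_algebra B"
  proof -
    have "xs ! \<pi> g \<in> {0, 1}" if "signature A g = Some n" "xs \<in> tuples {0, 1} n" for g n and xs :: "nat list"
      using that \<pi> nth_mem unfolding tuples_def by blast
    then have "is_algebra B" unfolding is_algebra_def by (simp add: B_def J_def del: One_nat_def)
    moreover have "\<exists>i<n. \<forall>xs\<in>tuples (carrier B) n. interp B g xs = xs ! i"
      if "signature B g = Some n" for g n
      by (rule exI[of _ "\<pi> g"]) (use \<pi> that in \<open>simp add: B_def J_def\<close>)
    ultimately show ?thesis unfolding projection_algebra_def by (intro conjI allI impI)
  qed
  have "0 \<in> carrier B" "1 \<in> carrier B" "0 \<noteq> (1::nat)" by (simp_all add: B_def)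
  from nontrivial_not_satisfies[OF assms(2,3) proj this] sat show False by (rule notE)
qed

section \<open>Compactness of the space of choices\<close>

text \<open>For an application, the set is a finite union over the argument chosen at the root: a
  cylinder intersected with the set for that argument.\<close>

lemma open_leading_var:
  assumes "t \<in> terms \<Omega> V"
  shows "openin (product_topology (\<lambda>g. discrete_topology {..<the (\<Omega> g)}) (dom \<Omega>))
    {\<pi> \<in> (\<Pi>\<^sub>E g\<in>dom \<Omega>. {..<the (\<Omega> g)}). leading_var \<pi> t = x}" (is "openin ?Z _")
  using assms
proof induction
  case (Var y)
  show ?case using openin_topspace[of ?Z] by (cases "x = y") simp_all
next
  case (App g ts)
  let ?P = "\<Pi>\<^sub>E g\<in>dom \<Omega>. {..<the (\<Omega> g)}"
  have g: "g \<in> dom \<Omega>" "the (\<Omega> g) = length ts" using App.hyps by auto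
  have "openin ?Z {\<pi> \<in> topspace ?Z. \<pi> g \<in> {i}}" if "i < length ts" for i
    by (rule openin_continuous_map_preimage[OF continuous_map_product_projection[OF g(1)]])
      (use that g in simp)
  then have "openin ?Z (\<Union>i<length ts. {\<pi> \<in> ?P. \<pi> g = i} \<inter> {\<pi> \<in> ?P. leading_var \<pi> (ts ! i) = x})"
    using App.IH by (intro openin_Union) (auto intro!: openin_Int)
  also have "(\<Union>i<length ts. {\<pi> \<in> ?P. \<pi> g = i} \<inter> {\<pi> \<in> ?P. leading_var \<pi> (ts ! i) = x}) =
      {\<pi> \<in> ?P. leading_var \<pi> (App g ts) = x}"
  proof -
    have "\<pi> g < length ts" if "\<pi> \<in> ?P" for \<pi> using PiE_mem[OF that g(1)] g by simp
    then show ?thesis by auto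
  qed
  finally show ?case .
qed

text \<open>The choices that violate a given identity form an open set, and the space of choices, a
  product of finite discrete spaces, is compact by Tychonoff's theorem.\<close>

lemma finitely_many_violated_identities:
  fixes \<Omega> :: "'g \<rightharpoonup> nat" and D :: "('g, 'v) identity set"
  assumes D: "D \<subseteq> terms \<Omega> V \<times> terms \<Omega> V"
    and violated: "\<And>\<pi>. (\<And>g n. \<Omega> g = Some n \<Longrightarrow> \<pi> g < n) \<Longrightarrow>
      \<exists>(t, t') \<in> D. leading_var \<pi> t \<noteq> leading_var \<pi> t'"
  obtains D0 where "finite D0" "D0 \<subseteq> D"
    "\<And>\<pi>. (\<And>g n. \<Omega> g = Some n \<Longrightarrow> \<pi> g < n) \<Longrightarrow>
      \<exists>(t, t') \<in> D0. leading_var \<pi> t \<noteq> leading_var \<pi> t'"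
proof -
  let ?P = "\<Pi>\<^sub>E g\<in>dom \<Omega>. {..<the (\<Omega> g)}"
  let ?Z = "product_topology (\<lambda>g. discrete_topology {..<the (\<Omega> g)}) (dom \<Omega>)"
  define W where "W = (\<lambda>(t, t'). {\<pi> \<in> ?P. leading_var \<pi> t \<noteq> leading_var \<pi> (t' :: ('g, 'v) trm)})"
  have opens: "openin ?Z (W d)" if d_in: "d \<in> D" for d
  proof -
    obtain t t' where d: "d = (t, t')" "t \<in> terms \<Omega> V" "t' \<in> terms \<Omega> V" using d_in D by auto
    have "openin ?Z ({\<pi> \<in> ?P. leading_var \<pi> t = x} \<inter> {\<pi> \<in> ?P. leading_var \<pi> t' = y})" for x y
      by (intro openin_Int open_leading_var[OF d(2)] open_leading_var[OF d(3)])
    then have "openin ?Z (\<Union>y\<in>-{x}. {\<pi> \<in> ?P. leading_var \<pi> t = x} \<inter> {\<pi> \<in> ?P. leading_var \<pi> t' = y})" for x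
      by (intro openin_Union) (elim imageE, simp only:)
    then have "openin ?Z (\<Union>x. \<Union>y\<in>-{x}. {\<pi> \<in> ?P. leading_var \<pi> t = x} \<inter> {\<pi> \<in> ?P. leading_var \<pi> t' = y})"
      by (intro openin_Union) (elim imageE, simp only:)
    also have "(\<Union>x. \<Union>y\<in>-{x}. {\<pi> \<in> ?P. leading_var \<pi> t = x} \<inter> {\<pi> \<in> ?P. leading_var \<pi> t' = y}) = W d"
      by (auto simp: W_def d)
    finally show ?thesis .
  qed
  have cov: "?P \<subseteq> \<Union> (W ` D)"
  proof
    fix \<pi> assume \<pi>: "\<pi> \<in> ?P"
    have "\<exists>(t, t') \<in> D. leading_var \<pi> t \<noteq> leading_var \<pi> t'"
    proof (rule violated)
      show "\<pi> g < n" if "\<Omega> g = Some n" for g n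
        using PiE_mem[OF \<pi>, of g] that by (simp add: domI)
    qed
    then show "\<pi> \<in> \<Union> (W ` D)" using \<pi> by (auto simp: W_def)
  qed
  have "compact_space ?Z"
    by (simp add: compact_space_product_topology compact_space_discrete_topology)
  then have comp: "compactin ?Z ?P" by (simp add: compact_space_def)
  have "openin ?Z U" if "U \<in> W ` D" for U
    using that by (elim imageE) (simp only: opens)
  then have "\<exists>\<F>. finite \<F> \<and> \<F> \<subseteq> W ` D \<and> ?P \<subseteq> \<Union>\<F>"
    by (rule compactinD[OF comp _ cov])
  then obtain \<F> where \<F>: "finite \<F>" "\<F> \<subseteq> W ` D" "?P \<subseteq> \<Union>\<F>"
    by (elim exE conjE) (rule that)
  then obtain D0 where D0: "finite D0" "D0 \<subseteq> D" "\<F> = W ` D0" by (meson finite_subset_image)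
  have "\<exists>(t, t') \<in> D0. leading_var \<pi> t \<noteq> leading_var \<pi> t'"
    if \<pi>: "\<And>g n. \<Omega> g = Some n \<Longrightarrow> \<pi> g < n" for \<pi>
  proof -
    \<comment> \<open>Points of the product are extensional functions; a term sees
      \<open>\<pi>\<close> only on \<open>dom \<Omega>\<close>, so an arbitrary choice may be
      restricted.\<close>
    have eq: "leading_var (restrict \<pi> (dom \<Omega>)) t = leading_var \<pi> t" if "t \<in> terms \<Omega> V" for t
      using that by induction (use \<pi> in \<open>auto simp: domI\<close>)
    have "restrict \<pi> (dom \<Omega>) \<in> ?P" using \<pi> by auto
    from subsetD[OF \<F>(3) this] obtain d where "d \<in> D0" "restrict \<pi> (dom \<Omega>) \<in> W d"
      unfolding D0(3) by (elim UN_E)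
    then obtain t t' where t: "(t, t') \<in> D0"
      "leading_var (restrict \<pi> (dom \<Omega>)) t \<noteq> leading_var (restrict \<pi> (dom \<Omega>)) t'"
      by (cases d) (simp add: W_def)
    have "t \<in> terms \<Omega> V" "t' \<in> terms \<Omega> V" using t(1) D0(2) D by auto
    with t show ?thesis by (auto simp: eq)
  qed
  with D0(1,2) show ?thesis by (rule that)
qed

section \<open>Operators preserving a ternary relation\<close>

text \<open>This isolates what is needed of the free algebra \<open>F\<close> with generators
  \<open>e 1\<close> to \<open>e 4\<close>; there, \<open>R_free\<close> follows from
  \<open>R_e\<close> and idempotence.\<close>

locale loop_relation =
  fixes F :: "'x set" and R :: "('x \<times> 'x \<times> 'x) set" and e :: "nat \<Rightarrow> 'x"
  assumes e_in: "i \<in> {1..4} \<Longrightarrow> e i \<in> F"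
    and R_e: "{i, j, k} \<subseteq> {1..4} \<Longrightarrow> \<not> (i = j \<and> j = k) \<Longrightarrow> (e i, e j, e k) \<in> R"
    and R_free: "{i, j} \<subseteq> {1..4} \<Longrightarrow> i \<noteq> j \<Longrightarrow> z \<in> F \<Longrightarrow> (e i, e j, z) \<in> R"
begin

text \<open>Arguments form a family on \<open>\<Lambda>\<close> instead of a list, so that words can
  serve as positions and composition becomes concatenation.\<close>

definition operator :: "'i set \<Rightarrow> (('i \<Rightarrow> 'x) \<Rightarrow> 'x) \<Rightarrow> bool" where
  "operator \<Lambda> f \<longleftrightarrow>
     (\<forall>\<rho> \<rho>'. (\<forall>p\<in>\<Lambda>. \<rho> p = \<rho>' p) \<longrightarrow> f \<rho> = f \<rho>') \<and>
     (\<forall>x\<in>F. f (\<lambda>_. x) = x) \<and>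
     (\<forall>\<rho>. (\<forall>p\<in>\<Lambda>. \<rho> p \<in> F) \<longrightarrow> f \<rho> \<in> F) \<and>
     (\<forall>\<rho> \<sigma> \<tau>. (\<forall>p\<in>\<Lambda>. (\<rho> p, \<sigma> p, \<tau> p) \<in> R) \<longrightarrow> (f \<rho>, f \<sigma>, f \<tau>) \<in> R)"

lemma operatorD:
  assumes "operator \<Lambda> f"
  shows operator_cong: "(\<And>p. p \<in> \<Lambda> \<Longrightarrow> \<rho> p = \<rho>' p) \<Longrightarrow> f \<rho> = f \<rho>'"
    and operator_idem: "x \<in> F \<Longrightarrow> f (\<lambda>_. x) = x"
    and operator_closed: "(\<And>p. p \<in> \<Lambda> \<Longrightarrow> \<rho> p \<in> F) \<Longrightarrow> f \<rho> \<in> F"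
    and operator_R: "(\<And>p. p \<in> \<Lambda> \<Longrightarrow> (\<rho> p, \<sigma> p, \<tau> p) \<in> R) \<Longrightarrow> (f \<rho>, f \<sigma>, f \<tau>) \<in> R"
  using assms unfolding operator_def by blast+

text \<open>The positions are divided into n classes. The k-th class carries a pair of tuples over x and y,
  given by the predicates P k and Q k, on which f agrees and which differ at each position of the
  class.\<close>

definition covered :: "'i set \<Rightarrow> (('i \<Rightarrow> 'x) \<Rightarrow> 'x) \<Rightarrow> nat \<Rightarrow> bool" where
  "covered \<Lambda> f n \<longleftrightarrow> (\<exists>cl P Q.
     (\<forall>k<n. \<forall>x\<in>F. \<forall>y\<in>F. f (\<lambda>p. if P k p then x else y) = f (\<lambda>p. if Q k p then x else y)) \<and>
     (\<forall>p\<in>\<Lambda>. cl p < n \<and> P (cl p) p \<noteq> Q (cl p) p))"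

lemma coveredE:
  assumes "covered \<Lambda> f n"
  obtains cl P Q where
    "\<And>k x y. k < n \<Longrightarrow> x \<in> F \<Longrightarrow> y \<in> F \<Longrightarrow>
      f (\<lambda>p. if P k p then x else y) = f (\<lambda>p. if Q k p then x else y)"
    "\<And>p. p \<in> \<Lambda> \<Longrightarrow> cl p < n" "\<And>p. p \<in> \<Lambda> \<Longrightarrow> P (cl p) p \<noteq> Q (cl p) p"
  using assms unfolding covered_def
  apply (elim exE conjE)
  subgoal premises prems for cl P Q
    by (rule prems(1)[of P Q cl]) (use prems(2,3) in simp_all)
  done

lemma covered_mono:
  assumes "covered \<Lambda> f m" "m \<le> n"
  shows "covered \<Lambda> f n"
proof -
  obtain cl P Q where
    loops: "\<forall>k<m. \<forall>x\<in>F. \<forall>y\<in>F. f (\<lambda>p. if P k p then x else y) = f (\<lambda>p. if Q k p then x else y)"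
    and cl: "\<forall>p\<in>\<Lambda>. cl p < m \<and> P (cl p) p \<noteq> Q (cl p) p"
    using assms(1) unfolding covered_def by blast
  show ?thesis
    unfolding covered_def
    \<comment> \<open>Indices from \<open>m\<close> on are the class of no position and get the
      trivial equation.\<close>
    by (rule exI[of _ cl], rule exI[of _ P], rule exI[of _ "\<lambda>k. if k < m then Q k else P k"])
      (use loops cl assms(2) in fastforce)
qed

text \<open>The constant triple consists of three copies of w, which stands for f(f(...)) with entry U at
  (p, q) if p and q have the same class and V otherwise. Unfold two copies of w twice and keep the
  third. If they become U, unfold them to a v-term that remembers the class of p, and
  then along its two tuples, while the third copy is unfolded to U or V: either the class has
  been guessed correctly, so that a and b occur, or the third copy is V. If they become V, unfold one
  of them at p and the other one at q: either the classes differ, or the third copy becomes U. With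
  only four generators, the third value of c has to be built from those of U, and swapping
  the generators 1 and 2 in U makes (U', U', U) a member of R.\<close>

lemma covered_three_const:
  assumes f: "operator \<Lambda> f" and "covered \<Lambda> f 3"
  shows "\<exists>w. (w, w, w) \<in> R"
proof -
  from assms(2) obtain cl P Q where
    loop: "\<And>k x y. k < 3 \<Longrightarrow> x \<in> F \<Longrightarrow> y \<in> F \<Longrightarrow>
      f (\<lambda>p. if P k p then x else y) = f (\<lambda>p. if Q k p then x else y)"
    and cl: "\<And>p. p \<in> \<Lambda> \<Longrightarrow> cl p < (3::nat)" "\<And>p. p \<in> \<Lambda> \<Longrightarrow> P (cl p) p \<noteq> Q (cl p) p"
    by (rule coveredE) (rule that)
  note idem = operator_idem[OF f] and closed = operator_closed[OF f] and pres = operator_R[OF f]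
  \<comment> \<open>For \<open>k < 3\<close> and arguments in \<open>F\<close>,
    \<open>v k x y\<close> can be unfolded along \<open>P k\<close> or along
    \<open>Q k\<close>.\<close>
  define v where "v k x y = f (\<lambda>p. if P k p then x else y)" for k x y
  have v_closed: "v k x y \<in> F" if "x \<in> F" "y \<in> F" for k x y
    unfolding v_def by (rule closed) (use that in simp)
  have e: "e 1 \<in> F" "e 2 \<in> F" "e 3 \<in> F" "e 4 \<in> F" by (simp_all add: e_in)
  define a where "a = v 2 (e 1) (e 2)"
  define b where "b = v 2 (e 2) (e 1)"
  have ab: "a \<in> F" "b \<in> F" unfolding a_def b_def by (intro v_closed e)+
  define U where "U = f (\<lambda>p. v (cl p) a b)"
  define U' where "U' = f (\<lambda>p. v (cl p) b a)"
  have UU': "U \<in> F" "U' \<in> F" unfolding U_def U'_def by (intro closed v_closed ab)+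
  define c where "c k = (if k = 0 then e 3 else if k = 1 then e 4 else U')" for k :: nat
  have c_closed: "c k \<in> F" for k using e UU' by (simp add: c_def)
  define V where "V = f (\<lambda>p. c (cl p))"
  have V: "V \<in> F" unfolding V_def by (intro closed c_closed)
  define w1 where "w1 k = f (\<lambda>q. if k = cl q then U else V)" for k
  have w1_closed: "w1 k \<in> F" for k unfolding w1_def using UU' V by (intro closed) simp
  define w where "w = f (\<lambda>p. w1 (cl p))"
  have w: "w \<in> F" unfolding w_def by (intro closed w1_closed)

  \<comment> \<open>The digits in these names tell which entries are unfolded; the others are read
    as \<open>f\<close> of a constant tuple.\<close>
  have pres12: "(f \<rho>, f \<sigma>, z) \<in> R" if "z \<in> F" "\<And>p. p \<in> \<Lambda> \<Longrightarrow> (\<rho> p, \<sigma> p, z) \<in> R" for \<rho> \<sigma> z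
    using pres[of \<rho> \<sigma> "\<lambda>_. z"] that by (simp add: idem)
  have pres1: "(f \<rho>, y, z) \<in> R" if "y \<in> F" "z \<in> F" "\<And>p. p \<in> \<Lambda> \<Longrightarrow> (\<rho> p, y, z) \<in> R" for \<rho> y z
    using pres[of \<rho> "\<lambda>_. y" "\<lambda>_. z"] that by (simp add: idem)
  have pres2: "(x, f \<sigma>, z) \<in> R" if "x \<in> F" "z \<in> F" "\<And>p. p \<in> \<Lambda> \<Longrightarrow> (x, \<sigma> p, z) \<in> R" for x \<sigma> z
    using pres[of "\<lambda>_. x" \<sigma> "\<lambda>_. z"] that by (simp add: idem)
  have pres3: "(x, y, f \<tau>) \<in> R" if "x \<in> F" "y \<in> F" "\<And>p. p \<in> \<Lambda> \<Longrightarrow> (x, y, \<tau> p) \<in> R" for x y \<tau>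
    using pres[of "\<lambda>_. x" "\<lambda>_. y" \<tau>] that by (simp add: idem)
  have pres13: "(f \<rho>, y, f \<tau>) \<in> R" if "y \<in> F" "\<And>p. p \<in> \<Lambda> \<Longrightarrow> (\<rho> p, y, \<tau> p) \<in> R" for \<rho> y \<tau>
    using pres[of \<rho> "\<lambda>_. y" \<tau>] that by (simp add: idem)
  have pres23: "(x, f \<sigma>, f \<tau>) \<in> R" if "x \<in> F" "\<And>p. p \<in> \<Lambda> \<Longrightarrow> (x, \<sigma> p, \<tau> p) \<in> R" for x \<sigma> \<tau>
    using pres[of "\<lambda>_. x" \<sigma> \<tau>] that by (simp add: idem)

  have free: "(e i, e j, z) \<in> R" if "z \<in> F" "i \<noteq> j" "{i, j} \<subseteq> {1..4}" for i j z
    using R_free that by blast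
  have free12: "(e 1, e 2, z) \<in> R" "(e 2, e 1, z) \<in> R" if "z \<in> F" for z
    using free that by auto
  \<comment> \<open>Unfolded along the same \<open>P 2\<close>, \<open>a\<close> and
    \<open>b\<close> give generators 1 and 2 in some order at each position, and these admit any
    third entry.\<close>
  have ab_free: "(a, b, z) \<in> R" "(b, a, z) \<in> R" if "z \<in> F" for z
    unfolding a_def b_def v_def by (rule pres12[OF that]; use free12 that in auto)+

  have gen_U: "(e i, e i, x) \<in> R" if "x = v k (e 1) (e 2) \<or> x = v k (e 2) (e 1)" "i = 3 \<or> i = 4" for x k i
    using that e unfolding v_def by (auto intro!: pres3 R_e)
  have "(e i, e i, U) \<in> R" if "i = 3 \<or> i = 4" for i
  proof -
    have "(e i, e i, a) \<in> R" "(e i, e i, b) \<in> R"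
      using gen_U that unfolding a_def b_def by blast+
    then show ?thesis unfolding U_def v_def using that e by (auto intro!: pres3)
  qed
  moreover have "(U', U', U) \<in> R"
  proof -
    have "(a, a, b) \<in> R" "(b, b, a) \<in> R"
      unfolding a_def b_def v_def by (auto intro!: pres R_e)
    then show ?thesis unfolding U_def U'_def v_def by (intro pres) auto
  qed
  ultimately have cc_U: "(c k, c k, U) \<in> R" for k by (auto simp: c_def)

  have U'_free: "(e i, U', z) \<in> R" "(U', e i, z) \<in> R" if "i = 3 \<or> i = 4" "z \<in> F" for i z
  proof -
    have ei: "e i \<in> F" using that e by blast
    have "(e i, a, z) \<in> R" "(e i, b, z) \<in> R" unfolding a_def b_def v_def
      by (rule pres2[OF ei that(2)]; use that in \<open>auto intro!: free\<close>)+
    then show "(e i, U', z) \<in> R" unfolding U'_def v_def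
      by (intro pres2[OF ei that(2)]) auto
    have "(a, e i, z) \<in> R" "(b, e i, z) \<in> R" unfolding a_def b_def v_def
      by (rule pres1[OF ei that(2)]; use that in \<open>auto intro!: free\<close>)+
    then show "(U', e i, z) \<in> R" unfolding U'_def v_def
      by (intro pres1[OF ei that(2)]) auto
  qed
  have c_free: "(c k, c l, z) \<in> R" if "k < 3" "l < 3" "k \<noteq> l" "z \<in> F" for k l z
    using that U'_free[of 3 z] U'_free[of 4 z] free[of z 3 4] free[of z 4 3]
    by (auto simp: c_def)

  \<comment> \<open>One copy is unfolded along \<open>P 2\<close>, the other along
    \<open>Q 2\<close>. In class 2 this gives distinct generators, which tolerate the entry
    \<open>U'\<close> of \<open>V\<close>; in the other classes \<open>V\<close> has generator 3 or
    4, which differs from 1 and 2.\<close>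
  have aa_V: "(v 2 x y, v 2 x y, V) \<in> R" if xy: "(x, y) = (e 1, e 2) \<or> (x, y) = (e 2, e 1)" for x y
  proof -
    have F: "x \<in> F" "y \<in> F" using xy e by auto
    have "(f (\<lambda>p. if P 2 p then x else y), f (\<lambda>p. if Q 2 p then x else y), V) \<in> R"
      unfolding V_def
    proof (rule pres)
      fix p assume p: "p \<in> \<Lambda>"
      show "(if P 2 p then x else y, if Q 2 p then x else y, c (cl p)) \<in> R"
      proof (cases "cl p = 2")
        case True
        then have "P 2 p \<noteq> Q 2 p" using cl(2)[OF p] by simp
        then show ?thesis using xy free12[OF c_closed] by auto
      next
        case False
        then have "cl p = 0 \<or> cl p = 1" using cl(1)[OF p] by linarith
        then have "c (cl p) = e 3 \<or> c (cl p) = e 4" by (auto simp: c_def)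
        moreover have "(e i, e j, e k) \<in> R" if "i = 1 \<or> i = 2" "j = 1 \<or> j = 2" "k = 3 \<or> k = 4" for i j k
          using that by (intro R_e) auto
        ultimately show ?thesis using xy by auto
      qed
    qed
    then show ?thesis using F by (simp add: v_def loop)
  qed

  have "(U, U, w) \<in> R"
    unfolding U_def w_def
  proof (rule pres)
    fix p assume p: "p \<in> \<Lambda>"
    have "(f (\<lambda>q. if P (cl p) q then a else b), f (\<lambda>q. if Q (cl p) q then a else b), w1 (cl p)) \<in> R"
      unfolding w1_def
    proof (rule pres)
      fix q assume q: "q \<in> \<Lambda>"
      have "(a, a, V) \<in> R" "(b, b, V) \<in> R" unfolding a_def b_def using aa_V by blast+
      then show "(if P (cl p) q then a else b, if Q (cl p) q then a else b,
          if cl p = cl q then U else V) \<in> R"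
        using cl(2)[OF q] ab_free UU' V by auto
    qed
    then show "(v (cl p) a b, v (cl p) a b, w1 (cl p)) \<in> R"
      using cl(1)[OF p] ab by (simp add: v_def loop)
  qed
  moreover have "(V, V, w) \<in> R"
  proof -
    have "(f (\<lambda>p. c (cl p)), V, f (\<lambda>p. w1 (cl p))) \<in> R"
    proof (rule pres13[OF V])
      fix p assume p: "p \<in> \<Lambda>"
      show "(c (cl p), V, w1 (cl p)) \<in> R"
        unfolding V_def w1_def
      proof (rule pres23[OF c_closed])
        fix q assume q: "q \<in> \<Lambda>"
        show "(c (cl p), c (cl q), if cl p = cl q then U else f (\<lambda>p. c (cl p))) \<in> R"
          using cc_U c_free cl(1)[OF p] cl(1)[OF q] V by (simp add: V_def)
      qed
    qed
    then show ?thesis by (simp add: V_def w_def)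
  qed
  ultimately have step: "(if k = l then U else V, if k = l then U else V, w) \<in> R" for k l :: nat
    by simp
  have "(w, w, w) \<in> R"
  proof -
    have "(w1 k, w1 k, w) \<in> R" for k
      unfolding w1_def by (rule pres12[OF w]) (use step in simp)
    then show ?thesis using pres12[OF w, of "\<lambda>p. w1 (cl p)" "\<lambda>p. w1 (cl p)"] by (simp add: w_def)
  qed
  then show ?thesis by blast
qed

section \<open>Reducing the number of equations by self-composition\<close>

lemma operator_compose:
  fixes \<Lambda> :: "'c list set"
  assumes f: "operator \<Lambda> f" and "\<Lambda> \<subseteq> {p. length p = L}"
  shows "operator {p @ q |p q. p \<in> \<Lambda> \<and> q \<in> \<Lambda>} (\<lambda>\<rho>. f (\<lambda>p. f (\<lambda>q. \<rho> (p @ q))))"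
  unfolding operator_def
proof (intro conjI allI impI ballI)
  fix \<rho> \<rho>' :: "'c list \<Rightarrow> 'x" assume "\<forall>r\<in>{p @ q |p q. p \<in> \<Lambda> \<and> q \<in> \<Lambda>}. \<rho> r = \<rho>' r"
  then show "f (\<lambda>p. f (\<lambda>q. \<rho> (p @ q))) = f (\<lambda>p. f (\<lambda>q. \<rho>' (p @ q)))"
    by (intro operator_cong[OF f]) blast
qed (auto intro!: operatorD[OF f] simp: operator_idem[OF f])

lemma nat_eq_if_bits_eq:
  fixes k l :: nat
  assumes "k < 2 ^ m" "l < 2 ^ m" "\<And>b. b < m \<Longrightarrow> bit k b = bit l b"
  shows "k = l"
proof -
  have "take_bit m k = take_bit m l"
    by (rule bit_eqI) (use assms(3) in \<open>auto simp: bit_take_bit_iff\<close>)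
  then show ?thesis using assms(1,2) by (simp add: take_bit_nat_eq_self)
qed

text \<open>Pairs (p, q) with equal classes form one new class: its tuples at (p, q) are those of the class of
  p, read at q. The remaining pairs are classified by a binary digit in which the two class numbers
  differ: its tuples are that digit for p and that digit for q.\<close>

lemma covered_compose:
  assumes f: "operator \<Lambda> f" and L: "\<Lambda> \<subseteq> {p. length p = L}"
    and "covered \<Lambda> f n" "n \<le> 2 ^ m"
  shows "covered {p @ q |p q. p \<in> \<Lambda> \<and> q \<in> \<Lambda>} (\<lambda>\<rho>. f (\<lambda>p. f (\<lambda>q. \<rho> (p @ q)))) (Suc m)"
proof -
  from assms(3) obtain cl P Q where
    loop: "\<And>k x y. k < n \<Longrightarrow> x \<in> F \<Longrightarrow> y \<in> F \<Longrightarrow>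
      f (\<lambda>p. if P k p then x else y) = f (\<lambda>p. if Q k p then x else y)"
    and cl: "\<And>p. p \<in> \<Lambda> \<Longrightarrow> cl p < n" "\<And>p. p \<in> \<Lambda> \<Longrightarrow> P (cl p) p \<noteq> Q (cl p) p"
    by (rule coveredE) (rule that)
  note cong = operator_cong[OF f] and idem = operator_idem[OF f] and closed = operator_closed[OF f]
  \<comment> \<open>All words in \<open>\<Lambda>\<close> have length \<open>L\<close>, so a
    concatenation determines its halves.\<close>
  define c1 c2 where "c1 r = cl (take L r)" and "c2 r = cl (drop L r)" for r
  define P' where "P' k r = (if k = m then P (c1 r) (drop L r) else bit (c1 r) k)" for k r
  define Q' where "Q' k r = (if k = m then Q (c1 r) (drop L r) else bit (c2 r) k)" for k r
  define cl' where "cl' r = (if c1 r = c2 r then m else (SOME b. b < m \<and> bit (c1 r) b \<noteq> bit (c2 r) b))" for r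
  have cl'_bit: "cl' r < m \<and> bit (c1 r) (cl' r) \<noteq> bit (c2 r) (cl' r)"
    if "c1 r \<noteq> c2 r" "c1 r < n" "c2 r < n" for r
  proof -
    have "\<exists>b. b < m \<and> bit (c1 r) b \<noteq> bit (c2 r) b"
      using nat_eq_if_bits_eq[of "c1 r" m "c2 r"] that assms(4) by fastforce
    from someI_ex[OF this] show ?thesis using that(1) by (simp add: cl'_def)
  qed
  have halves: "c1 (p @ q) = cl p" "c2 (p @ q) = cl q" "drop L (p @ q) = q" if "p \<in> \<Lambda>" for p q
    using that L by (auto simp: c1_def c2_def)
  have loops: "f (\<lambda>p. f (\<lambda>q. if P' k (p @ q) then x else y)) = f (\<lambda>p. f (\<lambda>q. if Q' k (p @ q) then x else y))"
    if "x \<in> F" "y \<in> F" for k x y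
  proof (cases "k = m")
    case True
    show ?thesis
      by (rule cong) (use True loop that cl in \<open>simp add: P'_def Q'_def halves del: drop_append\<close>)
  next
    case False
    \<comment> \<open>The digit tuples depend on one half only, so idempotence removes one layer of
      \<open>f\<close> and both sides reduce to \<open>?g\<close>.\<close>
    let ?g = "f (\<lambda>p. if bit (cl p) k then x else y)"
    have g: "?g \<in> F" using that by (intro closed) simp
    have "f (\<lambda>p. f (\<lambda>q. if P' k (p @ q) then x else y)) = ?g"
      by (rule cong) (use False that in \<open>simp add: P'_def halves idem\<close>)
    moreover have "f (\<lambda>p. f (\<lambda>q. if Q' k (p @ q) then x else y)) = f (\<lambda>p. ?g)"
      by (rule cong) (use False that in \<open>simp add: Q'_def halves\<close>)
    ultimately show ?thesis using idem[OF g] by simp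
  qed
  have cover: "cl' r < Suc m \<and> P' (cl' r) r \<noteq> Q' (cl' r) r"
    if r: "r = p @ q" "p \<in> \<Lambda>" "q \<in> \<Lambda>" for r p q
  proof (cases "c1 r = c2 r")
    case True
    then show ?thesis using cl(2)[OF r(3)] r by (simp add: cl'_def P'_def Q'_def halves del: drop_append)
  next
    case False
    then have "cl' r < m \<and> bit (c1 r) (cl' r) \<noteq> bit (c2 r) (cl' r)"
      by (rule cl'_bit) (use r cl(1) False in \<open>simp_all add: halves\<close>)
    then show ?thesis by (simp add: P'_def Q'_def)
  qed
  show ?thesis
    unfolding covered_def
  proof (rule exI[of _ cl'], rule exI[of _ P'], rule exI[of _ Q'], intro conjI allI impI ballI)
    show "f (\<lambda>p. f (\<lambda>q. if P' k (p @ q) then x else y)) = f (\<lambda>p. f (\<lambda>q. if Q' k (p @ q) then x else y))"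
      if "x \<in> F" "y \<in> F" for k x y
      using that by (rule loops)
    show "cl' r < Suc m" "P' (cl' r) r \<noteq> Q' (cl' r) r"
      if "r \<in> {p @ q |p q. p \<in> \<Lambda> \<and> q \<in> \<Lambda>}" for r
      using that cover by blast+
  qed
qed

text \<open>Self-composition turns \<open>n\<close> equations into \<open>m + 1\<close> whenever
  \<open>n \<le> 2 ^ m\<close>. For \<open>n \<ge> 4\<close> one may take \<open>m = n - 2\<close>,
  so the number drops by one each time until at most three remain.\<close>

lemma covered_const:
  assumes "operator \<Lambda> f" "\<Lambda> \<subseteq> {p. length p = L}" "covered \<Lambda> f n"
  shows "\<exists>w. (w, w, w) \<in> R"
  using assms
proof (induction n arbitrary: \<Lambda> f L rule: less_induct)
  case (less n)
  show ?case
  proof (cases "n \<le> 3")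
    case True
    from covered_three_const[OF less.prems(1) covered_mono[OF less.prems(3) this]] show ?thesis .
  next
    case False
    define m where "m = n - 2"
    have "m \<ge> 2" "n = m + 2" using False by (simp_all add: m_def)
    moreover have "m + 2 \<le> 2 ^ m" if "m \<ge> 2" for m :: nat
      using that by (induction rule: dec_induct) auto
    ultimately have nm: "n \<le> 2 ^ m" "Suc m < n" by auto
    have "{p @ q |p q. p \<in> \<Lambda> \<and> q \<in> \<Lambda>} \<subseteq> {p. length p = L + L}"
    proof clarify
      fix p q assume "p \<in> \<Lambda>" "q \<in> \<Lambda>"
      then have "length p = L" "length q = L" using less.prems(2) by auto
      then show "length (p @ q) = L + L" by simp
    qed
    from less.IH[OF nm(2) operator_compose[OF less.prems(1,2)] this
        covered_compose[OF less.prems nm(1)]]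
    show ?thesis .
  qed
qed

end

section \<open>Star composition and the descent into terms along words\<close>

text \<open>These are the leaf addresses of a tree with one layer per symbol of \<open>gs\<close>;
  they index the arguments of \<open>star\<close>. Letters keep their symbol so that
  \<open>descend\<close> can compare it with a root.\<close>

definition words :: "('g \<Rightarrow> nat) \<Rightarrow> 'g list \<Rightarrow> ('g \<times> nat) list set" where
  "words ar gs = {p. map fst p = gs \<and> (\<forall>(g, i)\<in>set p. i < ar g)}"

primrec star :: "('g \<Rightarrow> 'x list \<Rightarrow> 'x) \<Rightarrow> ('g \<Rightarrow> nat) \<Rightarrow> 'g list \<Rightarrow> (('g \<times> nat) list \<Rightarrow> 'x) \<Rightarrow> 'x" where
  "star J ar [] \<rho> = \<rho> []"
| "star J ar (g # gs) \<rho> = J g (map (\<lambda>i. star J ar gs (\<lambda>p. \<rho> ((g, i) # p))) [0..<ar g])"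

text \<open>A letter not matching the root is skipped, just as idempotence removes a layer with
  equal arguments.\<close>

fun descend :: "('g, 'v) trm \<Rightarrow> ('g \<times> nat) list \<Rightarrow> ('g, 'v) trm" where
  "descend t [] = t"
| "descend (Var x) ((h, i) # p) = descend (Var x) p"
| "descend (App g ts) ((h, i) # p) = descend (if g = h then ts ! i else App g ts) p"

lemma words_Nil [simp]: "words ar [] = {[]}"
  by (auto simp: words_def)

lemma words_Cons: "p \<in> words ar (g # gs) \<longleftrightarrow> (\<exists>i q. p = (g, i) # q \<and> i < ar g \<and> q \<in> words ar gs)"
  by (cases p) (auto simp: words_def)

lemma words_append: "p \<in> words ar (gs @ hs) \<longleftrightarrow> (\<exists>q r. p = q @ r \<and> q \<in> words ar gs \<and> r \<in> words ar hs)"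
proof
  assume p: "p \<in> words ar (gs @ hs)"
  then obtain q r where "p = q @ r" "map fst q = gs" "map fst r = hs"
    by (auto simp: words_def map_eq_append_conv)
  with p show "\<exists>q r. p = q @ r \<and> q \<in> words ar gs \<and> r \<in> words ar hs"
    by (intro exI[of _ q] exI[of _ r]) (auto simp: words_def)
qed (auto simp: words_def)

lemma words_length: "p \<in> words ar gs \<Longrightarrow> length p = length gs"
  by (auto simp: words_def)

lemma star_cong:
  assumes "\<And>p. p \<in> words ar gs \<Longrightarrow> \<rho> p = \<rho>' p"
  shows "star J ar gs \<rho> = star J ar gs \<rho>'"
  using assms
proof (induction gs arbitrary: \<rho> \<rho>')
  case (Cons g gs)
  have "star J ar gs (\<lambda>p. \<rho> ((g, i) # p)) = star J ar gs (\<lambda>p. \<rho>' ((g, i) # p))" if "i < ar g" for i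
    by (rule Cons.IH) (use that Cons.prems in \<open>simp add: words_Cons\<close>)
  then have "map (\<lambda>i. star J ar gs (\<lambda>p. \<rho> ((g, i) # p))) [0..<ar g] =
      map (\<lambda>i. star J ar gs (\<lambda>p. \<rho>' ((g, i) # p))) [0..<ar g]"
    by (intro map_cong refl) simp
  then show ?case by (simp only: star.simps)
qed simp

lemma descend_Var [simp]: "descend (Var x) p = Var x"
  by (induction p) auto

lemma descend_append: "descend t (p @ q) = descend (descend t p) q"
  by (induction t p rule: descend.induct) auto

lemma descend_in_terms:
  assumes "t \<in> terms \<Omega> V" "p \<in> words ar gs" "\<And>g n. \<Omega> g = Some n \<Longrightarrow> ar g = n"
  shows "descend t p \<in> terms \<Omega> V"
  using assms(1,2)
proof (induction t p arbitrary: gs rule: descend.induct)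
  case (3 g ts h i p)
  then have i: "i < ar h" and p: "p \<in> words ar (tl gs)" by (auto simp: words_def)
  from \<open>App g ts \<in> terms \<Omega> V\<close> have "\<Omega> g = Some (length ts)" "set ts \<subseteq> terms \<Omega> V"
    by (auto elim: terms.cases)
  with i assms(3) have "(if g = h then ts ! i else App g ts) \<in> terms \<Omega> V"
    using 3(2) nth_mem by fastforce
  then show ?case using "3.IH" p by simp
qed (auto simp: words_def)

lemma size_descend_le:
  assumes "t \<in> terms \<Omega> V" "p \<in> words ar gs" "\<And>g n. \<Omega> g = Some n \<Longrightarrow> ar g = n"
  shows "size (descend t p) \<le> size t"
  using assms(1,2)
proof (induction t p arbitrary: gs rule: descend.induct)
  case (3 g ts h i p)
  then have i: "i < ar h" and p: "p \<in> words ar (tl gs)" by (auto simp: words_def)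
  from \<open>App g ts \<in> terms \<Omega> V\<close> have "\<Omega> g = Some (length ts)" "set ts \<subseteq> terms \<Omega> V"
    by (auto elim: terms.cases)
  with i assms(3) have in_ts: "ts ! i \<in> set ts" "ts ! i \<in> terms \<Omega> V" if "g = h"
    using nth_mem that by fastforce+
  then have "size (ts ! i) \<le> size (App g ts)" if "g = h"
    using size_list_estimation'[of "ts ! i" ts "size (ts ! i)" size] that by simp
  moreover have "(if g = h then ts ! i else App g ts) \<in> terms \<Omega> V"
    using in_ts 3(2) by simp
  ultimately show ?case using "3.IH"[OF _ p] by (cases "g = h") fastforce+
qed auto

primrec symbols :: "('g, 'v) trm \<Rightarrow> 'g set" where
  "symbols (Var x) = {}"
| "symbols (App g ts) = insert g (\<Union> (set (map symbols ts)))"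

lemma finite_symbols: "finite (symbols t)"
  by (induction t) auto

lemma symbols_subset_dom: "t \<in> terms \<Omega> V \<Longrightarrow> symbols t \<subseteq> dom \<Omega>"
  by (induction rule: terms.induct) auto

lemma descend_symbols:
  assumes "t \<in> terms \<Omega> V" "p \<in> words ar gs" "\<And>g n. \<Omega> g = Some n \<Longrightarrow> ar g = n"
  shows "symbols (descend t p) \<subseteq> symbols t"
  using assms(1,2)
proof (induction t p arbitrary: gs rule: descend.induct)
  case (3 g ts h i p)
  then have i: "i < ar h" and p: "p \<in> words ar (tl gs)" by (auto simp: words_def)
  from \<open>App g ts \<in> terms \<Omega> V\<close> have "\<Omega> g = Some (length ts)" "set ts \<subseteq> terms \<Omega> V"
    by (auto elim: terms.cases)
  with i assms(3) have in_ts: "ts ! i \<in> set ts" "ts ! i \<in> terms \<Omega> V" if "g = h"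
    using nth_mem that by fastforce+
  have "symbols (if g = h then ts ! i else App g ts) \<subseteq> symbols (App g ts)"
    using in_ts by auto
  moreover have "(if g = h then ts ! i else App g ts) \<in> terms \<Omega> V"
    using in_ts 3(2) by simp
  ultimately show ?case using "3.IH"[OF _ p] by (simp only: descend.simps) blast
qed auto

text \<open>Letters are skipped until the first one with symbol \<open>g\<close>; it leads into a
  proper subterm, and later letters never increase the size.\<close>

lemma size_descend_less:
  assumes "App g ts \<in> terms \<Omega> V" "p \<in> words ar gs" "g \<in> set gs" "\<And>g n. \<Omega> g = Some n \<Longrightarrow> ar g = n"
  shows "size (descend (App g ts) p) < size (App g ts)"
  using assms(2,3)
proof (induction gs arbitrary: p)
  case (Cons h gs)
  then obtain i q where p: "p = (h, i) # q" "i < ar h" "q \<in> words ar gs"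
    by (auto simp: words_Cons)
  from assms(1) have ts: "\<Omega> g = Some (length ts)" "set ts \<subseteq> terms \<Omega> V"
    by (auto elim: terms.cases)
  show ?case
  proof (cases "g = h")
    case True
    with p ts assms(4) have in_ts: "ts ! i \<in> set ts" by fastforce
    then have "size (ts ! i) < size (App g ts)"
      using size_list_estimation'[OF in_ts, of "size (ts ! i)" size] by simp
    moreover have "size (descend (ts ! i) q) \<le> size (ts ! i)"
      using size_descend_le[OF _ p(3) assms(4)] in_ts ts by blast
    ultimately show ?thesis using True p by simp
  next
    case False
    then show ?thesis using Cons p by simp
  qed
qed simp

text \<open>Each block \<open>gs\<close> contains the root symbol of the term reached so far and
  hence shrinks it unless it is a variable.\<close>

lemma descend_finishes:
  assumes "t \<in> terms \<Omega> V" "symbols t \<subseteq> set gs" "size t \<le> d"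
    "p \<in> words ar (concat (replicate d gs))" "\<And>g n. \<Omega> g = Some n \<Longrightarrow> ar g = n"
  shows "\<exists>x\<in>V. descend t p = Var x"
  using assms(1-4)
proof (induction d arbitrary: t p)
  case 0
  then show ?case by (cases t) (auto elim: terms.cases)
next
  case (Suc d)
  show ?case
  proof (cases t)
    case (Var x)
    from Suc.prems(1)[unfolded Var] have "x \<in> V" by cases
    then show ?thesis using Var by simp
  next
    case (App g ts)
    obtain q r where p: "p = q @ r" "q \<in> words ar gs" "r \<in> words ar (concat (replicate d gs))"
      using Suc.prems(4) unfolding replicate_Suc concat.simps words_append by blast
    have "size (descend t q) < size t"
      using size_descend_less[OF _ p(2) _ assms(5)] Suc.prems(1,2) App by auto
    then have "size (descend t q) \<le> d" using Suc.prems(3) by simp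
    moreover have "symbols (descend t q) \<subseteq> set gs"
      using descend_symbols[OF Suc.prems(1) p(2) assms(5)] Suc.prems(2) by blast
    ultimately show ?thesis
      using Suc.IH[OF descend_in_terms[OF Suc.prems(1) p(2) assms(5)] _ _ p(3)]
      unfolding p(1) descend_append by blast
  qed
qed

text \<open>A letter consistent with \<open>\<pi>\<close> is either skipped or makes the very move
  with which \<open>leading_var\<close> starts.\<close>

lemma leading_var_descend:
  assumes "t \<in> terms \<Omega> V" "\<And>g n. \<Omega> g = Some n \<Longrightarrow> \<pi> g < n" "\<forall>(g, i)\<in>set p. \<pi> g = i"
  shows "leading_var \<pi> (descend t p) = leading_var \<pi> t"
  using assms(1,3)
proof (induction t p rule: descend.induct)
  case (3 g ts h i p)
  from 3(2) have g: "\<Omega> g = Some (length ts)" "set ts \<subseteq> terms \<Omega> V"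
    by (auto elim: terms.cases)
  have \<pi>: "\<pi> g < length ts" using assms(2)[OF g(1)] .
  have h: "g = h \<Longrightarrow> i = \<pi> g" "\<forall>(g, i)\<in>set p. \<pi> g = i" using 3(3) by auto
  have "ts ! \<pi> g \<in> terms \<Omega> V" using g(2) nth_mem[OF \<pi>] by blast
  then have "(if g = h then ts ! i else App g ts) \<in> terms \<Omega> V"
    using 3(2) h(1) by (cases "g = h") simp_all
  from "3.IH"[OF this h(2)] show ?case using h(1) \<pi> by simp
qed auto

section \<open>From basic operations to a covered operator\<close>

locale loop_relation_of_algebra = loop_relation F R e
  for F :: "'x set" and R e +
  fixes J :: "'g \<Rightarrow> 'x list \<Rightarrow> 'x" and \<Omega> :: "'g \<rightharpoonup> nat" and ar :: "'g \<Rightarrow> nat"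
  assumes ar: "\<Omega> g = Some n \<Longrightarrow> ar g = n"
    and J_idem: "g \<in> dom \<Omega> \<Longrightarrow> x \<in> F \<Longrightarrow> J g (replicate (ar g) x) = x"
    and J_closed: "g \<in> dom \<Omega> \<Longrightarrow> (\<And>i. i < ar g \<Longrightarrow> \<phi> i \<in> F) \<Longrightarrow> J g (map \<phi> [0..<ar g]) \<in> F"
    and J_R: "g \<in> dom \<Omega> \<Longrightarrow> (\<And>i. i < ar g \<Longrightarrow> (\<phi> i, \<psi> i, \<chi> i) \<in> R) \<Longrightarrow>
      (J g (map \<phi> [0..<ar g]), J g (map \<psi> [0..<ar g]), J g (map \<chi> [0..<ar g])) \<in> R"
begin

lemma operator_star:
  assumes "set gs \<subseteq> dom \<Omega>"
  shows "operator (words ar gs) (star J ar gs)"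
proof -
  have "star J ar gs (\<lambda>_. x) = x" if "x \<in> F" for x
    using assms by (induction gs) (use J_idem that in \<open>auto simp: map_replicate_const\<close>)
  moreover have "star J ar gs \<rho> \<in> F" if "\<forall>p\<in>words ar gs. \<rho> p \<in> F" for \<rho>
    using assms that
    by (induction gs arbitrary: \<rho>) (auto simp: words_Cons intro!: J_closed)
  moreover have "(star J ar gs \<rho>, star J ar gs \<sigma>, star J ar gs \<tau>) \<in> R"
    if "\<forall>p\<in>words ar gs. (\<rho> p, \<sigma> p, \<tau> p) \<in> R" for \<rho> \<sigma> \<tau>
    using assms that
    by (induction gs arbitrary: \<rho> \<sigma> \<tau>) (auto simp: words_Cons intro!: J_R)
  ultimately show ?thesis unfolding operator_def using star_cong by blast
qed

lemma star_idem: "set gs \<subseteq> dom \<Omega> \<Longrightarrow> x \<in> F \<Longrightarrow> star J ar gs (\<lambda>_. x) = x"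
  using operator_idem[OF operator_star] by blast

lemma eval_in_F:
  assumes "t \<in> terms \<Omega> V" "\<And>x. x \<in> V \<Longrightarrow> \<rho> x \<in> F"
  shows "eval J \<rho> t \<in> F"
  using assms(1)
proof induction
  case (App g ts)
  have "J g (map (\<lambda>i. eval J \<rho> (ts ! i)) [0..<ar g]) \<in> F"
    by (rule J_closed) (use App ar[OF App.hyps(1)] in auto)
  also have "map (\<lambda>i. eval J \<rho> (ts ! i)) [0..<ar g] = map (eval J \<rho>) ts"
    using ar[OF App.hyps(1)] by (intro nth_equalityI) auto
  finally show ?case by simp
qed (use assms(2) in simp)

text \<open>A layer matching the root distributes the arguments of the term to its branches; at any
  other layer all branches have the same value, and idempotence removes it.\<close>

lemma star_descend:
  assumes "set gs \<subseteq> dom \<Omega>" "t \<in> terms \<Omega> V" "\<And>x. x \<in> V \<Longrightarrow> \<rho> x \<in> F"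
  shows "star J ar gs (\<lambda>p. eval J \<rho> (descend t p)) = eval J \<rho> t"
  using assms(1,2)
proof (induction gs arbitrary: t)
  case (Cons g gs)
  then have g: "g \<in> dom \<Omega>" "set gs \<subseteq> dom \<Omega>" by auto
  have skip: ?case if "\<And>i p. descend t ((g, i) # p) = descend t p"
    using Cons.IH[OF g(2) Cons.prems(2)] J_idem[OF g(1) eval_in_F[OF Cons.prems(2) assms(3)]]
    by (simp add: that map_replicate_const)
  show ?case
  proof (cases t)
    case (Var x)
    then show ?thesis using skip by simp
  next
    case (App h ts)
    show ?thesis
    proof (cases "h = g")
      case True
      have ts: "\<Omega> g = Some (length ts)" "set ts \<subseteq> terms \<Omega> V"
        using Cons.prems(2) App True by (auto elim: terms.cases)
      have "map (\<lambda>i. star J ar gs (\<lambda>p. eval J \<rho> (descend (ts ! i) p))) [0..<ar g] = map (eval J \<rho>) ts"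
        using ar[OF ts(1)] Cons.IH[OF g(2)] ts(2) by (intro nth_equalityI) (auto simp: subset_iff)
      then show ?thesis using App True by simp
    next
      case False
      then show ?thesis using App skip by simp
    qed
  qed
qed simp

text \<open>All layers except number \<open>m\<close> receive equal arguments and vanish. Hence
  layers with the same symbol give the same value, the source of the equations between
  letters.\<close>

lemma star_position:
  assumes "set gs \<subseteq> dom \<Omega>" "m < length gs" "\<And>i. i < ar (gs ! m) \<Longrightarrow> \<phi> i \<in> F"
  shows "star J ar gs (\<lambda>p. \<phi> (snd (p ! m))) = J (gs ! m) (map \<phi> [0..<ar (gs ! m)])"
  using assms
proof (induction gs arbitrary: m)
  case (Cons g gs)
  then have g: "g \<in> dom \<Omega>" "set gs \<subseteq> dom \<Omega>" by auto
  show ?case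
  proof (cases m)
    case 0
    then have "map (\<lambda>i. star J ar gs (\<lambda>p. \<phi> i)) [0..<ar g] = map \<phi> [0..<ar g]"
      using star_idem[OF g(2)] Cons.prems(3) by simp
    then show ?thesis using 0 by (simp del: map_eq_conv)
  next
    case (Suc k)
    have k: "J (gs ! k) (map \<phi> [0..<ar (gs ! k)]) \<in> F" (is "?v \<in> F")
      using g(2) Cons.prems Suc by (intro J_closed) (auto simp: subset_iff)
    have "star J ar gs (\<lambda>p. \<phi> (snd (p ! k))) = ?v"
      using Cons.IH[OF g(2)] Cons.prems Suc by simp
    then show ?thesis using Suc J_idem[OF g(1) k] by (simp add: map_replicate_const)
  qed
qed simp

definition loop :: "'i set \<Rightarrow> (('i \<Rightarrow> 'x) \<Rightarrow> 'x) \<Rightarrow> ('i \<Rightarrow> bool) \<times> ('i \<Rightarrow> bool) \<Rightarrow> bool" where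
  "loop \<Lambda> f = (\<lambda>(P, Q). \<forall>x\<in>F. \<forall>y\<in>F. f (\<lambda>p. if P p then x else y) = f (\<lambda>p. if Q p then x else y))"

lemma covered_if_finite:
  assumes "finite S" "\<And>PQ. PQ \<in> S \<Longrightarrow> loop \<Lambda> f PQ" "\<And>p. p \<in> \<Lambda> \<Longrightarrow> \<exists>(P, Q)\<in>S. P p \<noteq> Q p"
  shows "covered \<Lambda> f (card S)"
proof -
  obtain h where h: "bij_betw h {..<card S} S"
    using ex_bij_betw_nat_finite[OF assms(1)] by (auto simp: atLeast0LessThan)
  have "\<exists>k<card S. fst (h k) p \<noteq> snd (h k) p" if p: "p \<in> \<Lambda>" for p
  proof -
    obtain PQ where "PQ \<in> S" "fst PQ p \<noteq> snd PQ p" using assms(3)[OF p] by (auto simp: split_beta)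
    then show ?thesis using h unfolding bij_betw_def by (metis imageE lessThan_iff)
  qed
  then obtain cl where cl: "\<And>p. p \<in> \<Lambda> \<Longrightarrow> cl p < card S \<and> fst (h (cl p)) p \<noteq> snd (h (cl p)) p"
    by metis
  have "loop \<Lambda> f (h k)" if "k < card S" for k
    using assms(2) bij_betwE[OF h] that by blast
  then show ?thesis
    unfolding covered_def loop_def
    by (intro exI[of _ cl] exI[of _ "\<lambda>k. fst (h k)"] exI[of _ "\<lambda>k. snd (h k)"])
      (use cl in \<open>auto simp: split_beta\<close>)
qed

text \<open>A path along which all occurrences of a symbol carry the same letter determines a choice of
  coordinates, and the two sides of an identity violated by it descend to different variables. On
  any other path two occurrences of some symbol carry different letters; these letters, compared with
  a constant c, provide the tuples.\<close>

lemma violated_identities_const: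
  fixes D :: "('g, nat) identity set"
  assumes D: "finite D" "D \<subseteq> terms \<Omega> {0, 1} \<times> terms \<Omega> {0, 1}"
    and holds: "\<And>t t' \<rho>. (t, t') \<in> D \<Longrightarrow> range \<rho> \<subseteq> F \<Longrightarrow> eval J \<rho> t = eval J \<rho> t'"
    and violated: "\<And>\<pi>. (\<And>g n. \<Omega> g = Some n \<Longrightarrow> \<pi> g < n) \<Longrightarrow>
      \<exists>(t, t') \<in> D. leading_var \<pi> t \<noteq> leading_var \<pi> t'"
    and pos: "\<And>g. g \<in> dom \<Omega> \<Longrightarrow> 0 < ar g"
  shows "\<exists>w. (w, w, w) \<in> R"
proof -
  define T where "T = fst ` D \<union> snd ` D"
  have T: "finite T" "T \<subseteq> terms \<Omega> {0, 1}" using D by (auto simp: T_def)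
  have DT: "t \<in> T" "t' \<in> T" if "(t, t') \<in> D" for t t' using that by (force simp: T_def)+
  have "finite (\<Union> (symbols ` T))" by (intro finite_UN_I T(1) finite_symbols)
  from finite_list[OF this] obtain gs where gs: "set gs = \<Union> (symbols ` T)" ..
  define d where "d = Max (size ` T)"
  have d: "size t \<le> d" if "t \<in> T" for t
    unfolding d_def using that T(1) by (intro Max_ge) auto
  \<comment> \<open>With as many blocks as the largest size in \<open>T\<close>, every word leads
    every term of \<open>T\<close> to a variable.\<close>
  define ws where "ws = concat (replicate d gs)"
  have "set ws \<subseteq> set gs" by (auto simp: ws_def)
  also have "\<dots> \<subseteq> dom \<Omega>" unfolding gs using symbols_subset_dom T(2) by (intro UN_least) blast
  finally have ws: "set ws \<subseteq> dom \<Omega>" .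
  have fin: "\<exists>x\<in>{0, 1}. descend t p = Var x" if "t \<in> T" "p \<in> words ar ws" for t p
  proof (rule descend_finishes[OF _ _ d[OF that(1)] that(2)[unfolded ws_def]])
    show "t \<in> terms \<Omega> {0, 1}" using that(1) T(2) by blast
    show "symbols t \<subseteq> set gs" using that(1) gs by blast
  qed (rule ar)

  \<comment> \<open>\<open>run t\<close> marks the positions where \<open>t\<close> ends in the
    variable 0; placing \<open>x\<close> there and \<open>y\<close> elsewhere makes the star
    composition compute \<open>t\<close>.\<close>
  define run where "run t = (\<lambda>p. descend t p = Var (0 :: nat))" for t :: "('g, nat) trm"
  define letter where "letter m c = (\<lambda>p :: ('g \<times> nat) list. snd (p ! m) = c)" for m c
  define S1 where "S1 = (\<lambda>(t, t'). (run t, run t')) ` D"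
  \<comment> \<open>Two layers with the same symbol are compared at a test letter \<open>c\<close>;
    both sides apply that symbol to \<open>x\<close> at \<open>c\<close> and \<open>y\<close>
    elsewhere.\<close>
  define S2 where "S2 = (\<lambda>(m, m', c). (letter m c, letter m' c)) `
    {(m, m', c). m < length ws \<and> m' < length ws \<and> ws ! m = ws ! m' \<and> c < ar (ws ! m)}"

  have run: "star J ar ws (\<lambda>p. if run t p then x else y) = eval J (\<lambda>v. if v = 0 then x else y) t"
    if t: "t \<in> T" and xy: "x \<in> F" "y \<in> F" for t x y
  proof -
    have "star J ar ws (\<lambda>p. if run t p then x else y) =
        star J ar ws (\<lambda>p. eval J (\<lambda>v. if v = 0 then x else y) (descend t p))"
    proof (rule star_cong)
      fix p assume "p \<in> words ar ws"
      then obtain v where "descend t p = Var v" using fin[OF t] by blast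
      then show "(if run t p then x else y) = eval J (\<lambda>v. if v = 0 then x else y) (descend t p)"
        by (simp add: run_def)
    qed
    also have "\<dots> = eval J (\<lambda>v. if v = 0 then x else y) t"
      by (rule star_descend[OF ws, of t "{0, 1}"]) (use t xy T(2) in auto)
    finally show ?thesis .
  qed
  have "loop (words ar ws) (star J ar ws) (run t, run t')" if tt': "(t, t') \<in> D" for t t'
  proof -
    have "star J ar ws (\<lambda>p. if run t p then x else y) = star J ar ws (\<lambda>p. if run t' p then x else y)"
      if "x \<in> F" "y \<in> F" for x y
      unfolding run[OF DT(1)[OF tt'] that] run[OF DT(2)[OF tt'] that]
      by (rule holds[OF tt']) (use that in auto)
    then show ?thesis by (simp add: loop_def)
  qed
  then have loop1: "loop (words ar ws) (star J ar ws) PQ" if "PQ \<in> S1" for PQ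
    using that by (auto simp: S1_def)

  have "star J ar ws (\<lambda>p. if letter m c p then x else y) =
      J (ws ! m) (map (\<lambda>i. if i = c then x else y) [0..<ar (ws ! m)])"
    if "m < length ws" "x \<in> F" "y \<in> F" for m c x y
    using star_position[OF ws that(1), of "\<lambda>i. if i = c then x else y"] that by (simp add: letter_def)
  then have loop2: "loop (words ar ws) (star J ar ws) PQ" if "PQ \<in> S2" for PQ
    using that by (auto simp: S2_def loop_def)

  have "finite {(m, m', c). m < length ws \<and> m' < length ws \<and> ws ! m = ws ! m' \<and> c < ar (ws ! m)}"
    by (rule finite_subset[of _ "{..<length ws} \<times> {..<length ws} \<times> (\<Union>m<length ws. {..<ar (ws ! m)})"]) auto
  then have finite: "finite (S1 \<union> S2)" using D(1) by (simp add: S1_def S2_def)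

  have cover: "\<exists>(P, Q)\<in>S1 \<union> S2. P p \<noteq> Q p" if p: "p \<in> words ar ws" for p
  proof (cases "\<exists>(P, Q)\<in>S2. P p \<noteq> Q p")
    case False
    have len: "length p = length ws" using words_length[OF p] .
    have p': "map fst p = ws" "\<And>g i. (g, i) \<in> set p \<Longrightarrow> i < ar g" using p by (auto simp: words_def)
    have p_nth: "p ! m = (ws ! m, snd (p ! m))" "snd (p ! m) < ar (ws ! m)" if m: "m < length ws" for m
    proof -
      have "fst (p ! m) = ws ! m" using m len p'(1) nth_map[of m p fst] by simp
      then show eq: "p ! m = (ws ! m, snd (p ! m))" by (metis prod.collapse)
      have "p ! m \<in> set p" using m len by simp
      then show "snd (p ! m) < ar (ws ! m)" using p'(2) eq by metis
    qed
    have same: "snd (p ! m) = snd (p ! m')"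
      if m: "m < length ws" "m' < length ws" "ws ! m = ws ! m'" for m m'
    proof -
      let ?c = "snd (p ! m)"
      have "(letter m ?c, letter m' ?c) \<in> S2"
        unfolding S2_def using m p_nth(2)[OF m(1)] by (intro image_eqI[of _ _ "(m, m', ?c)"]) auto
      with False have "letter m ?c p = letter m' ?c p" by blast
      then show ?thesis by (simp add: letter_def)
    qed
    have "\<forall>g. \<exists>m. g \<in> set ws \<longrightarrow> m < length ws \<and> ws ! m = g" by (auto simp: in_set_conv_nth)
    then obtain idx where idx: "\<And>g. g \<in> set ws \<Longrightarrow> idx g < length ws" "\<And>g. g \<in> set ws \<Longrightarrow> ws ! idx g = g"
      by metis
    \<comment> \<open>By \<open>same\<close> it does not matter which layer \<open>idx g\<close>
      picks. Symbols outside \<open>ws\<close> get coordinate 0, which is legal since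
      \<open>pos\<close> excludes nullary symbols.\<close>
    define \<pi> where "\<pi> g = (if g \<in> set ws then snd (p ! idx g) else 0)" for g
    have \<pi>: "\<pi> g < n" if g: "\<Omega> g = Some n" for g n
    proof (cases "g \<in> set ws")
      case True
      then show ?thesis using p_nth(2)[OF idx(1)[OF True]] idx(2)[OF True] ar[OF g] by (simp add: \<pi>_def)
    next
      case False
      then show ?thesis using pos[of g] ar[OF g] g by (simp add: \<pi>_def domI)
    qed
    have "\<pi> g = i" if "(g, i) \<in> set p" for g i
    proof -
      from that obtain m where m: "m < length ws" "p ! m = (g, i)"
        unfolding in_set_conv_nth len by (elim exE conjE)
      then have g: "ws ! m = g" using p_nth(1)[OF m(1)] by simp
      then have "g \<in> set ws" using m(1) by auto
      with same[OF m(1) idx(1)] idx(2) g m(2) show ?thesis by (simp add: \<pi>_def)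
    qed
    then have "\<forall>(g, i)\<in>set p. \<pi> g = i" by auto
    then have lead: "leading_var \<pi> (descend s p) = leading_var \<pi> s" if "s \<in> T" for s
      using that T(2) by (intro leading_var_descend[of _ \<Omega> "{0, 1}"] \<pi>) auto
    have "\<exists>(t, t') \<in> D. leading_var \<pi> t \<noteq> leading_var \<pi> t'" by (rule violated) (rule \<pi>)
    then obtain t t' where t: "(t, t') \<in> D" "leading_var \<pi> t \<noteq> leading_var \<pi> t'" by blast
    \<comment> \<open>Both sides descend to 0 or 1, and these are their leading variables; as they
      differ, exactly one is 0.\<close>
    have "run t p \<noteq> run t' p"
      using fin[OF DT(1)[OF t(1)] p] fin[OF DT(2)[OF t(1)] p] lead[OF DT(1)[OF t(1)]]
        lead[OF DT(2)[OF t(1)]] t(2) by (auto simp: run_def)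
    moreover have "(run t, run t') \<in> S1 \<union> S2"
      unfolding S1_def using t(1) by (intro UnI1 image_eqI[of _ _ "(t, t')"]) simp_all
    ultimately show ?thesis by (intro bexI[of _ "(run t, run t')"]) simp_all
  next
    case True
    then show ?thesis unfolding bex_Un by (rule disjI2)
  qed
  have "covered (words ar ws) (star J ar ws) (card (S1 \<union> S2))"
  proof (rule covered_if_finite[OF finite])
    show "loop (words ar ws) (star J ar ws) PQ" if "PQ \<in> S1 \<union> S2" for PQ
      using that by (elim UnE) (fact loop1 loop2)+
  qed (fact cover)
  moreover have "words ar ws \<subseteq> {p. length p = length ws}" by (auto simp: words_length)
  ultimately show ?thesis by (intro covered_const[OF operator_star[OF ws]])
qed

end

section \<open>The free algebra on four generators and the loop term\<close>

theorem theorem3p8: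
  fixes A :: "('g, 'a) algebra"
    and \<Omega> :: "'f \<rightharpoonup> nat"
    and E :: "('f, 'v) identity set"
    and ts :: "(nat \<times> nat \<times> nat) list"
  assumes "is_algebra A"
    and "idempotent A"
    and "identities_over \<Omega> E"
    and "nontrivial \<Omega> E"
    and "satisfies A \<Omega> E"
    and "distinct ts" and "set ts = nonconstant_triples"
  shows "satisfies A loop_signature_3_4 (loop_condition_3_4 ts)"
proof -
  define C where "C = carrier A"
  obtain a0 where a0: "a0 \<in> C" using assms(1) by (auto simp: is_algebra_def C_def)
  \<comment> \<open>Elements of the free algebra are functions of a valuation \<open>s\<close>; the
    default \<open>a0\<close> keeps the generators inside the carrier even where \<open>s\<close>
    leaves it.\<close>
  define nrm where "nrm s i = (if s i \<in> C then s i else a0)" for s :: "nat \<Rightarrow> 'a" and i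
  have nrm: "nrm s i \<in> C" for s i using a0 by (simp add: nrm_def)
  define J where "J g hs = (\<lambda>s :: nat \<Rightarrow> 'a. interp A g (map (\<lambda>h. h s) hs))" for g hs
  define ar where "ar g = the (signature A g)" for g
  define e where "e i = (\<lambda>s. nrm s i)" for i :: nat
  \<comment> \<open>\<open>F\<close> is the algebra of quaternary term operations under the
    pointwise operations \<open>J\<close>; \<open>R\<close> is the subalgebra of its cube generated
    by the triples in \<open>ts\<close>.\<close>
  define F where "F = eval J e ` terms (signature A) {1..4}"
  define R where "R = (\<lambda>t. (eval J (\<lambda>i. e (fst (ts ! i))) t, eval J (\<lambda>i. e (fst (snd (ts ! i)))) t,
    eval J (\<lambda>i. e (snd (snd (ts ! i)))) t)) ` terms (signature A) {..<60}"
  have len: "length ts = 60"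
    using distinct_card[OF assms(6)] assms(7) card_nonconstant_triples by simp
  have eval_J: "eval J \<rho> t s = eval (interp A) (\<lambda>i. \<rho> i s) t" for \<rho> :: "'c \<Rightarrow> _" and t s
    by (induction t) (auto simp: J_def intro!: arg_cong[where f = "interp A _"])
  have F_carrier: "x s \<in> C" if x: "x \<in> F" for x s
  proof -
    from x obtain t where "x = eval J e t" "t \<in> terms (signature A) {1..4}" unfolding F_def ..
    then show ?thesis
      using eval_closed[OF assms(1), of t "{1..4}" "nrm s"] nrm by (simp add: eval_J e_def C_def)
  qed
  have ar: "ar g = n" if "signature A g = Some n" for g n using that by (simp add: ar_def)
  have J_idem: "J g (replicate (ar g) x) = x" if "g \<in> dom (signature A)" "x \<in> F" for g x
    using that F_carrier assms(2) ar by (auto simp: J_def idempotent_def C_def)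
  have J_closed: "J g (map \<phi> [0..<ar g]) \<in> F"
    if g: "g \<in> dom (signature A)" and \<phi>: "\<And>i. i < ar g \<Longrightarrow> \<phi> i \<in> F" for g \<phi>
  proof -
    obtain u where u: "\<And>i. i < ar g \<Longrightarrow> u i \<in> terms (signature A) {1..4} \<and> \<phi> i = eval J e (u i)"
      using \<phi> unfolding F_def image_iff by metis
    have "App g (map u [0..<ar g]) \<in> terms (signature A) {1..4}"
      using g u ar by (intro terms.App) auto
    moreover have "J g (map \<phi> [0..<ar g]) = eval J e (App g (map u [0..<ar g]))"
      using u by (auto intro!: arg_cong[where f = "J g"])
    ultimately show ?thesis unfolding F_def by blast
  qed
  have J_R: "(J g (map \<phi> [0..<ar g]), J g (map \<psi> [0..<ar g]), J g (map \<chi> [0..<ar g])) \<in> R"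
    if g: "g \<in> dom (signature A)" and R: "\<And>i. i < ar g \<Longrightarrow> (\<phi> i, \<psi> i, \<chi> i) \<in> R" for g \<phi> \<psi> \<chi>
  proof -
    have "\<exists>u. u \<in> terms (signature A) {..<60} \<and> \<phi> i = eval J (\<lambda>i. e (fst (ts ! i))) u \<and>
        \<psi> i = eval J (\<lambda>i. e (fst (snd (ts ! i)))) u \<and> \<chi> i = eval J (\<lambda>i. e (snd (snd (ts ! i)))) u"
      if "i < ar g" for i using R[OF that] unfolding R_def by auto
    then obtain u where u: "\<And>i. i < ar g \<Longrightarrow> u i \<in> terms (signature A) {..<60} \<and>
        \<phi> i = eval J (\<lambda>i. e (fst (ts ! i))) (u i) \<and>
        \<psi> i = eval J (\<lambda>i. e (fst (snd (ts ! i)))) (u i) \<and>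
        \<chi> i = eval J (\<lambda>i. e (snd (snd (ts ! i)))) (u i)"
      by metis
    have "App g (map u [0..<ar g]) \<in> terms (signature A) {..<60}"
      using g u ar by (intro terms.App) auto
    moreover have "J g (map \<phi> [0..<ar g]) = eval J (\<lambda>i. e (fst (ts ! i))) (App g (map u [0..<ar g]))"
      "J g (map \<psi> [0..<ar g]) = eval J (\<lambda>i. e (fst (snd (ts ! i)))) (App g (map u [0..<ar g]))"
      "J g (map \<chi> [0..<ar g]) = eval J (\<lambda>i. e (snd (snd (ts ! i)))) (App g (map u [0..<ar g]))"
      using u by (auto intro!: arg_cong[where f = "J g"])
    ultimately show ?thesis unfolding R_def by blast
  qed
  have e_in: "e i \<in> F" if "i \<in> {1..4}" for i
    unfolding F_def using that by (intro image_eqI[of _ _ "Var i"]) (auto intro: terms.Var)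
  have R_e: "(e i, e j, e k) \<in> R" if "{i, j, k} \<subseteq> {1..4}" "\<not> (i = j \<and> j = k)" for i j k
  proof -
    have "(i, j, k) \<in> set ts" using that assms(7) by (simp add: nonconstant_triples_def)
    then obtain m where "m < 60" "ts ! m = (i, j, k)" by (metis in_set_conv_nth len)
    then show ?thesis unfolding R_def
      by (intro image_eqI[of _ _ "Var m"]) (auto intro: terms.Var)
  qed
  have R_free: "(e i, e j, z) \<in> R" if ij: "{i, j} \<subseteq> {1..4}" "i \<noteq> j" and z: "z \<in> F" for i j z
  proof -
    obtain t where "t \<in> terms (signature A) {1..4}" "z = eval J e t" using z unfolding F_def by blast
    \<comment> \<open>A variable gives a non-constant triple as \<open>i \<noteq> j\<close>; at an
      application, idempotence preserves \<open>e i\<close> and \<open>e j\<close>.\<close>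
    moreover have "(e i, e j, eval J e t) \<in> R" if "t \<in> terms (signature A) {1..4}" for t
      using that
    proof induction
      case (Var k)
      then show ?case using R_e ij by simp
    next
      case (App g us)
      have g: "g \<in> dom (signature A)" "ar g = length us" using App.hyps ar by auto
      have "(J g (map (\<lambda>_. e i) [0..<ar g]), J g (map (\<lambda>_. e j) [0..<ar g]),
          J g (map (\<lambda>k. eval J e (us ! k)) [0..<ar g])) \<in> R"
        by (rule J_R[OF g(1)]) (use App.IH g in simp)
      moreover have "map (\<lambda>k. eval J e (us ! k)) [0..<ar g] = map (eval J e) us"
        using g by (intro nth_equalityI) auto
      moreover have "J g (map (\<lambda>_. e l) [0..<ar g]) = e l" if "l \<in> {1..4}" for l
        using J_idem[OF g(1) e_in[OF that]] by (simp add: map_replicate_const)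
      ultimately show ?case using ij by simp
    qed
    ultimately show ?thesis by blast
  qed
  interpret loop_relation_of_algebra F R e J "signature A" ar
    by unfold_locales (fact e_in R_e R_free ar J_idem J_closed J_R)+
  have "\<exists>w. (w, w, w) \<in> R"
  proof (cases "\<exists>g. signature A g = Some 0")
    case True
    then obtain g where "signature A g = Some 0" by blast
    \<comment> \<open>An idempotent nullary symbol equals every element, so the generators
      coincide.\<close>
    then have const: "J g [] = x" if "x \<in> F" for x using J_idem[of g x] ar that by auto
    have "e 1 \<in> F" "e 2 \<in> F" by (simp_all add: e_in)
    from const[OF this(1)] const[OF this(2)] have "e 1 = e 2" by simp
    then show ?thesis using R_e[of 1 1 2] by auto
  next
    case False
    have "binary_identities A \<subseteq> terms (signature A) {0, 1} \<times> terms (signature A) {0, 1}"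
      by (auto simp: binary_identities_def)
    from finitely_many_violated_identities[OF this violated_identity[OF assms(1,3-5)]]
    obtain D where D: "finite D" "D \<subseteq> binary_identities A"
      "\<And>\<pi>. (\<And>g n. signature A g = Some n \<Longrightarrow> \<pi> g < n) \<Longrightarrow>
        \<exists>(t, t') \<in> D. leading_var \<pi> t \<noteq> leading_var \<pi> t'" by metis
    show ?thesis
    proof (rule violated_identities_const[OF D(1) _ _ D(3)])
      show "D \<subseteq> terms (signature A) {0, 1} \<times> terms (signature A) {0, 1}"
        using D(2) by (auto simp: binary_identities_def)
      show "eval J \<rho> t = eval J \<rho> t'" if "(t, t') \<in> D" "range \<rho> \<subseteq> F" for t t' \<rho>
      proof
        fix s
        have "range (\<lambda>i. \<rho> i s) \<subseteq> carrier A" using that(2) F_carrier by (auto simp: C_def)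
        then show "eval J \<rho> t s = eval J \<rho> t' s"
          using that(1) D(2) unfolding eval_J by (auto simp: binary_identities_def)
      qed
      show "0 < ar g" if "g \<in> dom (signature A)" for g using that False ar by (cases "ar g") force+
    qed
  qed
  \<comment> \<open>The constant triple comes from one term in 60 variables; its three equal
    evaluations are the sides of the loop condition.\<close>
  then obtain t where t: "t \<in> terms (signature A) {..<60}"
    "eval J (\<lambda>i. e (fst (ts ! i))) t = eval J (\<lambda>i. e (fst (snd (ts ! i)))) t"
    "eval J (\<lambda>i. e (fst (snd (ts ! i)))) t = eval J (\<lambda>i. e (snd (snd (ts ! i)))) t"
    unfolding R_def by auto
  define I where "I = (\<lambda>(_ :: unit) xs. eval (interp A) (\<lambda>i. xs ! i) t)"
  \<comment> \<open>\<open>nrm\<close> does not alter a valuation in the carrier, so elements of the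
    free algebra taken at \<open>\<rho>\<close> are values in \<open>A\<close>.\<close>
  have I: "eval I \<rho> (App () (map (\<lambda>p. Var (\<phi> p)) ts)) = eval J (\<lambda>i. e (\<phi> (ts ! i))) t \<rho>"
    if "range \<rho> \<subseteq> carrier A" for \<phi> and \<rho> :: "nat \<Rightarrow> 'a"
  proof -
    have "nrm \<rho> i = \<rho> i" for i using that by (auto simp: nrm_def C_def)
    then show ?thesis
      unfolding eval_J by (simp add: I_def) (rule eval_cong[OF t(1)], simp add: len e_def)
  qed
  have "term_operation A n (I f)" if "loop_signature_3_4 f = Some n" for f n
    using that t(1) by (auto simp: loop_signature_3_4_def term_operation_def I_def)
  moreover have "eval I \<rho> u = eval I \<rho> v"
    if uv: "(u, v) \<in> loop_condition_3_4 ts" and \<rho>: "range \<rho> \<subseteq> carrier A" for u v \<rho>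
  proof -
    consider "u = App () (map (\<lambda>p. Var (fst p)) ts)" "v = App () (map (\<lambda>p. Var (fst (snd p))) ts)"
      | "u = App () (map (\<lambda>p. Var (fst (snd p))) ts)" "v = App () (map (\<lambda>p. Var (snd (snd p))) ts)"
      using uv by (auto simp: loop_condition_3_4_def Let_def case_prod_unfold)
    then show ?thesis by cases (simp_all only: I[OF \<rho>] t(2,3))
  qed
  ultimately show ?thesis unfolding satisfies_def by blast
qed

end
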